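(* For infinitely many integers $\epsilon \geq 1$, there is a surface of Euler genus $\epsilon$ and a graph $G$ such that $G$ embeds on that surface with all vertices of $G$ on one face $F$ of the embedding, $G$ does not contain the complete graph $K_{H(\epsilon)-2}$, and $G$ is not $(H(\epsilon)-3)$-list-colorable, where $H(\epsilon) = \lfloor (7 + \sqrt{24\epsilon + 1})/2 \rfloor$.
   Context: Graphs are finite and simple. A surface is a compact connected 2-manifold without boundary; its Euler genus is $2-\chi$, where $\chi$ is its Euler characteristic (the surface may be orientable or nonorientable). A face of an embedding is a connected component of the complement of the embedded graph in the surface; a vertex is on a face if it is on the boundary of that face. Given a list $L(v)$ of colors for each vertex $v$ of $G$, the graph can be $L$-list-colored if a color from $L(v)$ can be selected for each $v$ so that adjacent vertices receive different colors. A graph is $k$-list-colorable if it can be $L$-list-colored whenever $|L(v)| \geq k$ for every vertex $v$. $K_m$ is the complete graph on $m$ vertices. *)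

theory Defs
  imports "HOL-Analysis.Analysis" "HOL-Library.Ramsey"
begin

text \<open>Surfaces: nonempty compact connected 2-manifolds without boundary. Points have neighbourhoods
  homeomorphic to open subsets of the whole plane, so boundary points are excluded.\<close>

definition surface :: "'a topology \<Rightarrow> bool" where
  "surface X \<longleftrightarrow>
     topspace X \<noteq> {} \<and> compact_space X \<and> connected_space X \<and>
     Hausdorff_space X \<and> second_countable X \<and>
     (\<forall>x \<in> topspace X. \<exists>U. openin X U \<and> x \<in> U \<and>
        (\<exists>W :: (real^2) set. open W \<and> subtopology X U homeomorphic_space top_of_set W))"

text \<open>The Euler characteristic is the alternating number of simplices (by dimension) of a finite
  simplicial complex triangulating the space. It does not depend on the triangulation (classical),
  so this relation determines at most one \<open>c\<close>. Every complex of dimension at most 2 is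
  realizable in \<open>\<real>\<^sup>5\<close>, so every surface has a triangulation of this form. The library's
  complexes may contain the empty simplex, which is not counted.\<close>

definition has_euler_characteristic :: "'a topology \<Rightarrow> int \<Rightarrow> bool" where
  "has_euler_characteristic X c \<longleftrightarrow>
     (\<exists>\<C> :: (real^5) set set.
        simplicial_complex \<C> \<and> X homeomorphic_space top_of_set (\<Union>\<C>) \<and>
        c = (\<Sum>S \<in> \<C> - {{}}. (- 1) ^ nat (aff_dim S)))"

definition has_euler_genus :: "'a topology \<Rightarrow> int \<Rightarrow> bool" where
  "has_euler_genus X g \<longleftrightarrow> has_euler_characteristic X (2 - g)"

definition simple_graph :: "'v set \<Rightarrow> 'v set set \<Rightarrow> bool" where
  "simple_graph V E \<longleftrightarrow> finite V \<and> E \<subseteq> [V]\<^bsup>2\<^esup>"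

definition contains_complete :: "'v set \<Rightarrow> 'v set set \<Rightarrow> nat \<Rightarrow> bool" where
  "contains_complete V E m \<longleftrightarrow> (\<exists>K \<subseteq> V. finite K \<and> card K = m \<and> [K]\<^bsup>2\<^esup> \<subseteq> E)"

definition list_colored :: "'v set \<Rightarrow> 'v set set \<Rightarrow> ('v \<Rightarrow> 'c set) \<Rightarrow> ('v \<Rightarrow> 'c) \<Rightarrow> bool" where
  "list_colored V E L c \<longleftrightarrow>
     (\<forall>v \<in> V. c v \<in> L v) \<and> (\<forall>u \<in> V. \<forall>v \<in> V. {u, v} \<in> E \<longrightarrow> c u \<noteq> c v)"

text \<open>Natural numbers suffice as colors, since the graphs and the lists are finite.\<close>

definition list_colorable :: "nat \<Rightarrow> 'v set \<Rightarrow> 'v set set \<Rightarrow> bool" where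
  "list_colorable k V E \<longleftrightarrow>
     (\<forall>L :: 'v \<Rightarrow> nat set. (\<forall>v \<in> V. finite (L v) \<and> k \<le> card (L v)) \<longrightarrow>
        (\<exists>c. list_colored V E L c))"

text \<open>An embedding places the vertices at distinct points \<open>p v\<close> and draws every edge \<open>e\<close> as a
  simple arc \<open>\<gamma> e\<close> joining the points of its two ends; arcs meet the vertices and each other
  only at common ends. No condition is put on the faces (the embedding need not be cellular).\<close>

definition graph_embedding ::
    "'a topology \<Rightarrow> 'v set \<Rightarrow> 'v set set \<Rightarrow> ('v \<Rightarrow> 'a) \<Rightarrow> ('v set \<Rightarrow> real \<Rightarrow> 'a) \<Rightarrow> bool" where
  "graph_embedding X V E p \<gamma> \<longleftrightarrow>
     p ` V \<subseteq> topspace X \<and> inj_on p V \<and>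
     (\<forall>e \<in> E. pathin X (\<gamma> e) \<and> inj_on (\<gamma> e) {0..1} \<and>
        {\<gamma> e 0, \<gamma> e 1} = p ` e \<and> \<gamma> e ` {0<..<1} \<inter> p ` V = {}) \<and>
     (\<forall>e \<in> E. \<forall>f \<in> E. e \<noteq> f \<longrightarrow> \<gamma> e ` {0<..<1} \<inter> \<gamma> f ` {0<..<1} = {})"

definition embedded_graph ::
    "'v set \<Rightarrow> 'v set set \<Rightarrow> ('v \<Rightarrow> 'a) \<Rightarrow> ('v set \<Rightarrow> real \<Rightarrow> 'a) \<Rightarrow> 'a set" where
  "embedded_graph V E p \<gamma> = p ` V \<union> (\<Union>e \<in> E. \<gamma> e ` {0..1})"

definition faces ::
    "'a topology \<Rightarrow> 'v set \<Rightarrow> 'v set set \<Rightarrow> ('v \<Rightarrow> 'a) \<Rightarrow> ('v set \<Rightarrow> real \<Rightarrow> 'a) \<Rightarrow> 'a set set" where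
  "faces X V E p \<gamma> =
     connected_components_of (subtopology X (topspace X - embedded_graph V E p \<gamma>))"

definition heawood :: "nat \<Rightarrow> nat" where
  "heawood \<epsilon> = nat \<lfloor>(7 + sqrt (24 * real \<epsilon> + 1)) / 2\<rfloor>"

end

theory Submission
  imports Defs
begin

text \<open>
The idea is to start from a surface triangulated by a complete graph minus one edge. Suppose that
\<open>K\<^sub>n\<close> minus an edge triangulates a surface of Euler genus \<open>\<epsilon>\<close>. Euler's formula gives
\<open>6 \<epsilon> + 2 = (n - 3) (n - 4)\<close>, from which \<open>H(\<epsilon>) = n - 1\<close>. Remove a vertex that is not an end of the
missing edge. All other \<open>n - 1\<close> vertices are adjacent to it, hence lie on the boundary of the face that
takes its place. Remove four more edges, so that the five missing edges form a pentagon. What remains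
is the join of \<open>K\<^bsub>n-6\<^esub>\<close> and a 5-cycle. It has clique number \<open>n - 4 = H(\<epsilon>) - 3\<close> but chromatic
number \<open>n - 3 = H(\<epsilon>) - 2\<close>, and equal lists show that it is not \<open>(H(\<epsilon>) - 3)\<close>-list-colorable. This
part is \<open>near_complete_triangulation_example\<close>.

A triangulation given by its list of triangles is realized by straight simplices on vertices in
general position in \<open>\<real>\<^sup>5\<close>, where simplices meet only in common faces. The Euler characteristic is then
a count, and the only topological question is whether the union of the simplices is a manifold. It
is covered by the open stars of the vertices; when the link of a vertex is a cycle, its
star is mapped homeomorphically to the plane, link vertices going to the vertices of a regular
polygon (\<open>star_homeomorphic_planar\<close>). A link is a cycle as soon as it is connected and 2-regular.

It remains to triangulate infinitely many surfaces by complete graphs minus an edge. For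
\<open>m = 4 q + 1\<close> take three copies of the integers modulo \<open>m\<close>, arranged cyclically, and two poles, which
are the ends of the missing edge, so \<open>n = 3 m + 2 = 12 q + 5\<close>. Two points of a copy form a triangle with a
translate of their midpoint in the next copy, and with a translate of their midpoint in the previous
copy. A point and a point of another copy then lie in two such triangles, unless the
midpoint construction degenerates because the base points coincide; in this case one pole, or the
other, fills the gap. This is a Bose-type construction used twice. The link of a point alternates
between two reflections of the integers modulo \<open>m\<close>, and the translations are chosen such that the
resulting path, together with the poles, is one cycle (\<open>dihedral_walk\<close>, \<open>link_connected_pt\<close>).
The genus is \<open>24 q\<^sup>2 + 6 q\<close>.
\<close>

section \<open>Points in general position\<close>

text \<open>The points come from the moment curve \<open>t \<mapsto> (t, t\<^sup>2, \<dots>, t\<^sup>N)\<close> with \<open>N = DIM('a)\<close>: an affine dependence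
among at most \<open>N + 1\<close> of its points is a linear functional that kills every polynomial of degree
at most \<open>N\<close>, restricted to the parameters involved, and such polynomials separate those parameters.
In \<open>\<real>\<^sup>5\<close> this makes the vertices of any two triangles affinely independent.\<close>

lemma ex_infinite_general_position:
  "\<exists>S :: 'a::euclidean_space set. infinite S \<and>
     (\<forall>F \<subseteq> S. finite F \<longrightarrow> card F \<le> DIM('a) + 1 \<longrightarrow> \<not> affine_dependent F)"
proof -
  let ?N = "DIM('a)"
  obtain b :: "nat \<Rightarrow> 'a" where b: "bij_betw b {0..<?N} Basis"
    using ex_bij_betw_nat_finite[OF finite_Basis] by blast
  define P :: "real \<Rightarrow> 'a" where "P t = (\<Sum>k\<in>{0..<?N}. t ^ Suc k *\<^sub>R b k)" for t
  have Pb: "P t \<bullet> b k = t ^ Suc k" if "k < ?N" for t k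
  proof -
    have "b j \<bullet> b k = (if j = k then 1 else 0)" if "j < ?N" for j
    proof -
      have "b j \<in> Basis" "b k \<in> Basis"
        using b that \<open>k < ?N\<close> by (auto simp: bij_betw_def)
      moreover have "b j = b k \<longleftrightarrow> j = k"
        using b that \<open>k < ?N\<close> by (auto simp: bij_betw_def inj_on_def)
      ultimately show ?thesis by (simp add: inner_Basis)
    qed
    then have "P t \<bullet> b k = (\<Sum>j\<in>{0..<?N}. if j = k then t ^ Suc j else 0)"
      unfolding P_def inner_sum_left inner_scaleR_left by (intro sum.cong) auto
    then show ?thesis using that by simp
  qed
  have injP: "inj P"
  proof (rule injI)
    fix t u assume "P t = P u"
    then have "t ^ Suc 0 = u ^ Suc 0" using Pb[of 0, OF DIM_positive] by metis
    then show "t = u" by simp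
  qed
  have "\<not> affine_dependent F" if F: "F \<subseteq> range P" "finite F" "card F \<le> ?N + 1" for F
  proof
    assume "affine_dependent F"
    then obtain u v where u0: "sum u F = 0" and uF: "(\<Sum>x\<in>F. u x *\<^sub>R x) = 0"
      and v: "v \<in> F" "u v \<noteq> 0"
      using affine_dependent_explicit_finite[OF \<open>finite F\<close>] by blast
    define R where "R = P -` F"
    have R: "F = P ` R" "finite R" "card R = card F"
      using F injP by (auto simp: R_def finite_vimageI card_vimage_inj)
    define c where "c = u \<circ> P"
    have pow: "(\<Sum>t\<in>R. c t * t ^ k) = 0" if "k \<le> ?N" for k
    proof (cases k)
      case 0
      have "sum u F = sum c R"
        unfolding R(1) c_def by (rule sum.reindex) (use injP in \<open>auto simp: inj_on_def\<close>)
      then show ?thesis using 0 u0 by simp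
    next
      case (Suc j)
      have "0 = (\<Sum>x\<in>F. u x *\<^sub>R x) \<bullet> b j" by (simp add: uF)
      also have "\<dots> = (\<Sum>t\<in>R. c t *\<^sub>R P t) \<bullet> b j"
        unfolding R(1) c_def by (subst sum.reindex) (use injP in \<open>auto simp: inj_on_def\<close>)
      also have "\<dots> = (\<Sum>t\<in>R. c t * t ^ k)"
        using Suc that by (simp add: inner_sum_left Pb)
      finally show ?thesis by simp
    qed
    obtain s where s: "v = P s" "s \<in> R" using v R by auto
    \<comment> \<open>The polynomial vanishing on all parameters but \<open>s\<close> isolates the coefficient of \<open>s\<close>.\<close>
    define q where "q = (\<Prod>t\<in>R - {s}. [:- t, 1:])"
    have deg: "degree q \<le> ?N"
    proof -
      have "degree q \<le> (\<Sum>t\<in>R - {s}. degree [:- t, 1:])"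
          unfolding q_def using degree_prod_sum_le[of "R - {s}" "\<lambda>t. [:- t, 1:]"] R by (simp add: o_def)
      then show ?thesis using R s F by simp
    qed
    have "(\<Sum>t\<in>R. c t * poly q t) = (\<Sum>t\<in>R. \<Sum>k\<le>degree q. coeff q k * (c t * t ^ k))"
      by (simp add: poly_altdef sum_distrib_left mult_ac)
    also have "\<dots> = (\<Sum>k\<le>degree q. coeff q k * (\<Sum>t\<in>R. c t * t ^ k))"
      by (subst sum.swap) (simp add: sum_distrib_left)
    also have "\<dots> = 0"
      using deg by (intro sum.neutral) (auto simp: pow)
    finally have "(\<Sum>t\<in>R. c t * poly q t) = 0" .
    moreover have "poly q t = 0" if "t \<in> R - {s}" for t
      using that R by (auto simp: q_def poly_prod)
    then have "(\<Sum>t\<in>R. c t * poly q t) = c s * poly q s"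
      using R s by (subst sum.remove[of R s]) auto
    moreover have "poly q s \<noteq> 0"
      using R by (auto simp: q_def poly_prod)
    ultimately show False using v s by (simp add: c_def)
  qed
  moreover have "infinite (range P)"
    using injP finite_imageD infinite_UNIV_char_0 by blast
  ultimately show ?thesis by blast
qed

section \<open>Connected 2-regular graphs are cycles\<close>

text \<open>On a longest path, both neighbours of the last vertex lie on the path; the second one can only be the
first vertex, because all inner vertices already have their two neighbours. So the path closes up to
a cycle, which is closed under adjacency and hence exhausts \<open>N\<close>.\<close>

lemma two_regular_connected_cyclic_list:
  fixes N :: "'a set" and A :: "'a \<Rightarrow> 'a set"
  assumes fin: "finite N" and "x \<in> N"
    and two: "\<And>u. u \<in> N \<Longrightarrow> card (A u) = 2"
    and sub: "\<And>u. u \<in> N \<Longrightarrow> A u \<subseteq> N - {u}"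
    and symA: "\<And>u w. u \<in> N \<Longrightarrow> w \<in> A u \<Longrightarrow> u \<in> A w"
    and conn: "\<And>S. S \<subseteq> N \<Longrightarrow> S \<noteq> {} \<Longrightarrow> (\<And>u. u \<in> S \<Longrightarrow> A u \<subseteq> S) \<Longrightarrow> S = N"
  shows "\<exists>us. distinct us \<and> set us = N \<and>
     (\<forall>u\<in>N. \<forall>w. w \<in> A u \<longleftrightarrow>
        (\<exists>i<length us. {u, w} = {us ! i, us ! (Suc i mod length us)}))"
proof -
  define path where "path us \<longleftrightarrow> us \<noteq> [] \<and> distinct us \<and> set us \<subseteq> N \<and>
     (\<forall>i. Suc i < length us \<longrightarrow> us ! Suc i \<in> A (us ! i))" for us
  have "path [x]" using \<open>x \<in> N\<close> by (simp add: path_def)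
  moreover have bound: "length us \<le> card N" if "path us" for us
    using that fin by (metis path_def distinct_card card_mono)
  ultimately obtain us where us: "path us" and max: "\<And>vs. path vs \<Longrightarrow> length vs \<le> length us"
    using ex_has_greatest_nat[of path "[x]" length "card N + 1"]
    by (metis (no_types, lifting) less_Suc_eq_le Suc_eq_plus1)
  define n where "n = length us"
  have n0: "n > 0" and dist: "distinct us" and usN: "set us \<subseteq> N"
    and step: "\<And>i. Suc i < n \<Longrightarrow> us ! Suc i \<in> A (us ! i)"
    using us by (auto simp: path_def n_def)
  have inN: "us ! i \<in> N" if "i < n" for i using usN that by (auto simp: n_def)
  have stepb: "us ! i \<in> A (us ! Suc i)" if "Suc i < n" for i
    using symA[OF inN step] that by simp
  have eqi: "us ! i = us ! j \<longleftrightarrow> i = j" if "i < n" "j < n" for i j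
    using dist that by (simp add: nth_eq_iff_index_eq n_def)
  have A3: "w \<in> {a, b}" if "u \<in> N" "a \<in> A u" "b \<in> A u" "a \<noteq> b" "w \<in> A u" for u a b w
  proof -
    obtain p q where "A u = {p, q}" using two[OF \<open>u \<in> N\<close>] by (auto simp: card_2_iff)
    then show ?thesis using that by auto
  qed
  \<comment> \<open>By maximality both neighbours of the last vertex lie on the path.\<close>
  have lastsub: "A (us ! (n - 1)) \<subseteq> set us"
  proof
    fix w assume w: "w \<in> A (us ! (n - 1))"
    show "w \<in> set us"
    proof (rule ccontr)
      assume "w \<notin> set us"
      moreover have "w \<in> N" using w sub[OF inN[of "n - 1"]] n0 by auto
      moreover have "(us @ [w]) ! Suc i \<in> A ((us @ [w]) ! i)" if "Suc i < Suc n" for i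
      proof (cases "Suc i = n")
        case True
        then have "i = n - 1" by simp
        then show ?thesis using True w n0 by (simp add: nth_append n_def)
      next
        case False
        then show ?thesis using that step[of i] by (simp add: nth_append n_def)
      qed
      ultimately have "path (us @ [w])"
        using usN dist by (simp add: path_def n_def)
      then show False using max by fastforce
    qed
  qed
  have n2: "n \<ge> 2"
  proof (rule ccontr)
    assume "\<not> n \<ge> 2"
    then have "n = 1" using n0 by simp
    then have "set us = {us ! 0}" by (auto simp: n_def length_Suc_conv)
    then have "A (us ! 0) \<subseteq> {}" using lastsub sub[OF inN[of 0]] n0 \<open>n = 1\<close> by auto
    then show False using two[OF inN[of 0]] n0 by simp
  qed
  obtain w where w: "w \<in> A (us ! (n - 1))" "w \<noteq> us ! (n - 2)"
  proof -
    obtain p q where "A (us ! (n - 1)) = {p, q}" "p \<noteq> q"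
      using two[OF inN[of "n - 1"]] n0 by (auto simp: card_2_iff)
    then show ?thesis using that by (metis insertCI)
  qed
  obtain j where j: "j < n" "w = us ! j"
    using lastsub w by (metis n_def in_mono in_set_conv_nth)
  have "j \<noteq> n - 1" using w(1) j sub[OF inN[of "n - 1"]] n0 by auto
  moreover have "j \<noteq> n - 2" using w j by auto
  ultimately have jn: "Suc (Suc j) < n" using j by simp
  have "j = 0"
  proof (rule ccontr)
    assume "j \<noteq> 0"
    then obtain i where i: "j = Suc i" by (cases j) auto
    have "us ! (n - 1) \<in> A (us ! j)" using symA[OF inN w(1)] j n0 by simp
    moreover have "us ! i \<in> A (us ! j)" using stepb[of i] i j by simp
    moreover have "us ! Suc j \<in> A (us ! j)" using step[of j] jn by simp
    moreover have "us ! i \<noteq> us ! Suc j" using eqi[of i "Suc j"] i jn by simp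
    ultimately have "us ! (n - 1) \<in> {us ! i, us ! Suc j}"
      using A3[OF inN[OF j(1)]] by blast
    then show False using eqi[of "n - 1"] i jn by auto
  qed
  then have n3: "n \<ge> 3" and close: "us ! 0 \<in> A (us ! (n - 1))" using jn w j by auto
  have next_adj: "us ! (Suc i mod n) \<in> A (us ! i)" if "i < n" for i
  proof (cases "Suc i < n")
    case False
    then have "i = n - 1" using that by simp
    then show ?thesis using close n0 by simp
  qed (simp add: step)
  have Suc_mod: "Suc i mod n < n" for i using n0 by simp
  have prev: "\<exists>k<n. Suc k mod n = i" if "i < n" for i
  proof (cases i)
    case 0
    then show ?thesis using n0 by (intro exI[of _ "n - 1"]) auto
  next
    case (Suc k)
    then show ?thesis using that by (intro exI[of _ k]) auto
  qed
  have Aeq: "A (us ! i) = {us ! (Suc i mod n), us ! k}" if "i < n" "k < n" "Suc k mod n = i" for i k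
  proof -
    have "us ! k \<in> A (us ! i)" using symA[OF inN next_adj] that by auto
    moreover have "us ! (Suc i mod n) \<noteq> us ! k"
    proof -
      have "Suc i mod n \<noteq> k"
        using that n3 by (cases "Suc k = n"; cases "Suc i = n") auto
      then show ?thesis using eqi[OF Suc_mod that(2)] by simp
    qed
    ultimately show ?thesis using A3[OF inN] next_adj that by blast
  qed
  have setN: "set us = N"
  proof (rule conn[OF usN])
    show "set us \<noteq> {}" using n0 by (auto simp: n_def)
    fix u assume "u \<in> set us"
    then obtain i where i: "i < n" "u = us ! i" by (auto simp: n_def in_set_conv_nth)
    obtain k where "k < n" "Suc k mod n = i" using prev[OF i(1)] by blast
    then show "A u \<subseteq> set us" using Aeq[OF i(1)] i Suc_mod by (auto simp: n_def)
  qed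
  moreover have "w \<in> A u \<longleftrightarrow> (\<exists>i<n. {u, w} = {us ! i, us ! (Suc i mod n)})" if "u \<in> N" for u w
  proof
    assume wA: "w \<in> A u"
    have "u \<in> set us" using that setN by simp
    then obtain i where "i < length us" "us ! i = u" unfolding in_set_conv_nth by blast
    then have i: "i < n" "u = us ! i" by (simp_all add: n_def)
    obtain k where k: "k < n" "Suc k mod n = i" using prev[OF i(1)] by blast
    have "w = us ! (Suc i mod n) \<or> w = us ! k" using wA Aeq[OF i(1) k] i(2) by simp
    then show "\<exists>i<n. {u, w} = {us ! i, us ! (Suc i mod n)}"
    proof
      assume "w = us ! k"
      then have "{u, w} = {us ! k, us ! (Suc k mod n)}" using i k by auto
      then show ?thesis using k by blast
    qed (use i in blast)
  next
    assume "\<exists>i<n. {u, w} = {us ! i, us ! (Suc i mod n)}"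
    then obtain i where i: "i < n" "{u, w} = {us ! i, us ! (Suc i mod n)}" by blast
    have "us ! i \<in> A (us ! (Suc i mod n))" by (rule symA[OF inN next_adj]) (use i in auto)
    then show "w \<in> A u"
      using next_adj[OF i(1)] i(2) by (auto simp: doubleton_eq_iff)
  qed
  ultimately show ?thesis using dist unfolding n_def by blast
qed

section \<open>A complete fan in the plane\<close>

text \<open>The rays through the vertices \<open>w k\<close> of a regular \<open>d\<close>-gon cut the plane into \<open>d\<close> sectors, and \<open>s k z\<close> is
the coordinate of \<open>z\<close> at the ray \<open>k\<close> when \<open>z\<close> is written in the two rays bounding its sector. These
coordinates are the planar counterpart of barycentric coordinates around a vertex of degree \<open>d\<close>.
Defining \<open>s k\<close> piecewise over the sectors would leave its continuity to be glued; instead it is one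
formula, the positive part of the minimum of two determinants. That the minimum picks the right
determinant in the sector next to ray \<open>k\<close> needs \<open>sin (2 \<tau>) \<ge> 0\<close> for the sector angle \<open>\<tau>\<close>, which is
where \<open>d \<ge> 4\<close> comes from.\<close>

lemma complete_fan_complex:
  fixes d :: nat
  assumes d: "d \<ge> 4"
  obtains w :: "nat \<Rightarrow> complex" and s :: "nat \<Rightarrow> complex \<Rightarrow> real"
  where "\<And>k. continuous_on UNIV (s k)" "\<And>k. norm (w k) = 1"
    "\<And>k i a b. \<lbrakk>k < d; i < d; 0 \<le> a; 0 \<le> b\<rbrakk> \<Longrightarrow>
       s k (of_real a * w i + of_real b * w (Suc i mod d)) =
         (if k = i then a else if k = Suc i mod d then b else 0)"
    "\<And>z. \<exists>i a b. i < d \<and> 0 \<le> a \<and> 0 \<le> b \<and> z = of_real a * w i + of_real b * w (Suc i mod d)"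
proof -
  define \<tau> where "\<tau> = 2 * pi / real d"
  have d\<tau>: "real d * \<tau> = 2 * pi" using d by (simp add: \<tau>_def)
  have \<tau>: "0 < \<tau>" "\<tau> \<le> pi / 2"
    using d pi_gt_zero by (auto simp: \<tau>_def field_simps)
  have sin\<tau>: "sin \<tau> > 0" using \<tau> pi_gt_zero by (intro sin_gt_zero) linarith+
  have sin2\<tau>: "sin (2 * \<tau>) \<ge> 0" using \<tau> by (intro sin_ge_zero) auto
  define w where "w k = cis (real k * \<tau>)" for k :: nat
  define f where "f k z = Im (cnj z * cis ((real k + 1) * \<tau>)) / sin \<tau>" for k :: nat and z
  define g where "g k z = Im (cnj (cis ((real k - 1) * \<tau>)) * z) / sin \<tau>" for k :: nat and z
  define s where "s k z = max 0 (min (f k z) (g k z))" for k :: nat and z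
  have w_mod: "w (Suc i mod d) = cis ((real i + 1) * \<tau>)" if "i < d" for i
  proof (cases "Suc i = d")
    case True
    then have "(real i + 1) * \<tau> = 2 * pi" using d\<tau> by (auto simp: add.commute)
    then show ?thesis using True by (simp add: w_def)
  next
    case False
    then show ?thesis using that by (simp add: w_def add.commute)
  qed
  have f_eq: "f k (of_real a * w i + of_real b * cis ((real i + 1) * \<tau>)) =
      (a * sin ((real k - real i + 1) * \<tau>) + b * sin ((real k - real i) * \<tau>)) / sin \<tau>" for k i a b
  proof -
    have "cnj (of_real a * w i + of_real b * cis ((real i + 1) * \<tau>)) * cis ((real k + 1) * \<tau>) =
        of_real a * cis ((real k - real i + 1) * \<tau>) + of_real b * cis ((real k - real i) * \<tau>)"
      by (simp add: w_def cis_cnj algebra_simps cis_mult)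
    then show ?thesis by (simp add: f_def)
  qed
  have g_eq: "g k (of_real a * w i + of_real b * cis ((real i + 1) * \<tau>)) =
      (a * sin ((real i - real k + 1) * \<tau>) + b * sin ((real i - real k + 2) * \<tau>)) / sin \<tau>" for k i a b
  proof -
    have "cnj (cis ((real k - 1) * \<tau>)) * (of_real a * w i + of_real b * cis ((real i + 1) * \<tau>)) =
        of_real a * cis ((real i - real k + 1) * \<tau>) + of_real b * cis ((real i - real k + 2) * \<tau>)"
      by (simp add: w_def cis_cnj algebra_simps cis_mult)
    then show ?thesis by (simp add: g_def)
  qed
  \<comment> \<open>Here \<open>n\<close> is the number of steps from ray \<open>i\<close> counterclockwise to ray \<open>k\<close>. If \<open>n\<close> is at least 2,
      the second determinant is nonpositive up to a half turn, and the first one beyond it.\<close>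
  have core: "max 0 (min ((a * sin ((real n + 1) * \<tau>) + b * sin (real n * \<tau>)) / sin \<tau>)
                ((a * sin ((1 - real n) * \<tau>) + b * sin ((2 - real n) * \<tau>)) / sin \<tau>)) =
      (if n = 0 then a else if n = 1 then b else 0)"
    if n: "n < d" and ab: "0 \<le> a" "0 \<le> b" for n a b
  proof -
    consider "n = 0" | "n = 1" | "n \<ge> 2" by linarith
    then show ?thesis
    proof cases
      case 1
      have "a \<le> (a * sin \<tau> + b * sin (2 * \<tau>)) / sin \<tau>"
        using ab sin\<tau> sin2\<tau> by (simp add: field_simps)
      then show ?thesis using 1 ab sin\<tau> by simp
    next
      case 2
      have "b \<le> (a * sin (2 * \<tau>) + b * sin \<tau>) / sin \<tau>"
        using ab sin\<tau> sin2\<tau> by (simp add: field_simps)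
      then show ?thesis using 2 ab sin\<tau> by simp
    next
      case 3
      have up: "(real n + 1) * \<tau> \<le> 2 * pi"
      proof -
        have "(real n + 1) * \<tau> \<le> real d * \<tau>" using n \<tau> by (intro mult_right_mono) auto
        then show ?thesis by (simp add: d\<tau>)
      qed
      have "min ((a * sin ((real n + 1) * \<tau>) + b * sin (real n * \<tau>)) / sin \<tau>)
              ((a * sin ((1 - real n) * \<tau>) + b * sin ((2 - real n) * \<tau>)) / sin \<tau>) \<le> 0"
      proof (cases "(real n - 1) * \<tau> \<le> pi")
        case True
        have "sin ((real n - 1) * \<tau>) \<ge> 0" using 3 \<tau> True by (intro sin_ge_zero) auto
        moreover have "sin ((real n - 2) * \<tau>) \<ge> 0"
          using 3 \<tau> True by (intro sin_ge_zero) (auto simp: algebra_simps)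
        moreover have "sin ((1 - real n) * \<tau>) = - sin ((real n - 1) * \<tau>)"
          "sin ((2 - real n) * \<tau>) = - sin ((real n - 2) * \<tau>)"
          by (simp_all flip: sin_minus add: algebra_simps)
        ultimately have "a * sin ((1 - real n) * \<tau>) \<le> 0" "b * sin ((2 - real n) * \<tau>) \<le> 0"
          using ab by (simp_all add: mult_nonneg_nonneg)
        then have "a * sin ((1 - real n) * \<tau>) + b * sin ((2 - real n) * \<tau>) \<le> 0" by linarith
        then show ?thesis using sin\<tau> by (simp add: min_le_iff_disj divide_le_0_iff)
      next
        case False
        then have "pi \<le> real n * \<tau>" "pi \<le> (real n + 1) * \<tau>" using \<tau> by (auto simp: algebra_simps)
        moreover have "real n * \<tau> < 2 * pi" using up \<tau> by (simp add: algebra_simps)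
        ultimately have "sin (real n * \<tau>) \<le> 0" "sin ((real n + 1) * \<tau>) \<le> 0"
          using sin_le_zero[of "real n * \<tau>"] up
            sin_le_zero[of "(real n + 1) * \<tau>"]
          by (auto simp: order.order_iff_strict)
        then have "a * sin ((real n + 1) * \<tau>) + b * sin (real n * \<tau>) \<le> 0"
          using ab by (simp add: mult_nonneg_nonpos add_nonpos_nonpos)
        then show ?thesis using sin\<tau> by (simp add: min_le_iff_disj divide_le_0_iff)
      qed
      then show ?thesis using 3 by simp
    qed
  qed
  show thesis
  proof
    show "continuous_on UNIV (s k)" for k
      unfolding s_def f_def g_def using sin\<tau> by (intro continuous_intros) auto
    show "norm (w k) = 1" for k by (simp add: w_def)
  next
    fix k i :: nat and a b :: real
    assume ki: "k < d" "i < d" and ab: "0 \<le> a" "0 \<le> b"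
    let ?z = "of_real a * w i + of_real b * w (Suc i mod d)"
    show "s k ?z = (if k = i then a else if k = Suc i mod d then b else 0)"
    proof (cases "i \<le> k")
      case True
      define n where "n = k - i"
      have n: "n < d" "real k - real i = real n" "real i - real k = - real n"
        using True ki by (auto simp: n_def of_nat_diff)
      have "s k ?z = (if n = 0 then a else if n = 1 then b else 0)"
        unfolding s_def w_mod[OF ki(2)] f_eq g_eq n using core[OF n(1) ab] by (simp add: algebra_simps)
      moreover have "n = 0 \<longleftrightarrow> k = i" using True by (auto simp: n_def)
      moreover have "n = 1 \<longleftrightarrow> k = Suc i mod d" if "k \<noteq> i"
      proof -
        have "Suc i mod d = Suc i" using that True ki by simp
        then show ?thesis using that True by (auto simp: n_def)
      qed
      ultimately show ?thesis by simp
    next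
      case False
      define n where "n = k + d - i"
      have n: "n < d" "real k - real i = real n - real d" "real i - real k = real d - real n"
        using False ki by (auto simp: n_def of_nat_diff)
      have per: "sin (x * \<tau> - real d * \<tau>) = sin (x * \<tau>)" "sin (real d * \<tau> + x * \<tau>) = sin (x * \<tau>)" for x
        by (simp_all add: d\<tau> sin_diff sin_add)
      have "(real n - real d + 1) * \<tau> = (real n + 1) * \<tau> - real d * \<tau>"
        "(real n - real d) * \<tau> = real n * \<tau> - real d * \<tau>"
        "(real d - real n + 1) * \<tau> = real d * \<tau> + (1 - real n) * \<tau>"
        "(real d - real n + 2) * \<tau> = real d * \<tau> + (2 - real n) * \<tau>"
        by (simp_all add: algebra_simps)
      then have "s k ?z = (if n = 0 then a else if n = 1 then b else 0)"
        unfolding s_def w_mod[OF ki(2)] f_eq g_eq n using core[OF n(1) ab] by (simp only: per)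
      moreover have "n \<noteq> 0" "k \<noteq> i" using False ki by (auto simp: n_def)
      moreover have "n = 1 \<longleftrightarrow> k = Suc i mod d"
      proof (cases "Suc i = d")
        case False
        then have "Suc i mod d = Suc i" using ki by simp
        then show ?thesis using \<open>\<not> i \<le> k\<close> ki False by (simp add: n_def)
      qed (use False in \<open>auto simp: n_def\<close>)
      ultimately show ?thesis by simp
    qed
  next
    fix z
    define \<theta> where "\<theta> = Arg2pi z"
    have \<theta>: "0 \<le> \<theta>" "\<theta> < 2 * pi" and z: "z = of_real (norm z) * cis \<theta>"
      using Arg2pi[of z] by (auto simp: \<theta>_def cis_conv_exp is_Arg_def)
    define i where "i = nat \<lfloor>\<theta> / \<tau>\<rfloor>"
    define \<phi> where "\<phi> = \<theta> - real i * \<tau>"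
    have "real i \<le> \<theta> / \<tau>" "\<theta> / \<tau> < real i + 1"
      using \<theta> \<tau> by (auto simp: i_def)
    then have \<phi>: "0 \<le> \<phi>" "\<phi> < \<tau>" using \<tau> by (auto simp: \<phi>_def field_simps)
    have "real i * \<tau> < real d * \<tau>" using \<phi> \<theta> d\<tau> by (simp add: \<phi>_def)
    then have id: "i < d" using \<tau> by simp
    define a where "a = norm z * sin (\<tau> - \<phi>) / sin \<tau>"
    define b where "b = norm z * sin \<phi> / sin \<tau>"
    have "sin \<phi> \<ge> 0" "sin (\<tau> - \<phi>) \<ge> 0" using \<phi> \<tau> pi_gt_zero by (auto intro!: sin_ge_zero)
    then have ab: "0 \<le> a" "0 \<le> b" using sin\<tau> by (auto simp: a_def b_def)
    have "of_real (sin (\<tau> - \<phi>)) + of_real (sin \<phi>) * cis \<tau> = of_real (sin \<tau>) * cis \<phi>"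
      by (simp add: complex_eq_iff sin_diff algebra_simps)
    then have "of_real a + of_real b * cis \<tau> = of_real (norm z) * cis \<phi>"
      using sin\<tau> by (simp add: a_def b_def field_simps) (metis distrib_left mult.left_commute)
    then have "cis (real i * \<tau>) * (of_real a + of_real b * cis \<tau>) = of_real (norm z) * (cis (real i * \<tau>) * cis \<phi>)"
      by simp
    also have "\<dots> = z" by (subst (2) z) (simp add: cis_mult \<phi>_def)
    finally have "cis (real i * \<tau>) * (of_real a + of_real b * cis \<tau>) = z" .
    moreover have "cis ((real i + 1) * \<tau>) = cis (real i * \<tau>) * cis \<tau>"
      by (simp add: cis_mult distrib_right)
    moreover have "w i = cis (real i * \<tau>)" by (simp add: w_def)
    ultimately have "z = of_real a * w i + of_real b * w (Suc i mod d)"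
      unfolding w_mod[OF id] by (simp add: algebra_simps)
    then show "\<exists>i a b. i < d \<and> 0 \<le> a \<and> 0 \<le> b \<and> z = of_real a * w i + of_real b * w (Suc i mod d)"
      using id ab by blast
  qed
qed

section \<open>The surface of a closed triangulation\<close>

definition link_nbrs :: "'v set set \<Rightarrow> 'v \<Rightarrow> 'v \<Rightarrow> 'v set" where
  "link_nbrs T v u = {w. u \<noteq> v \<and> w \<noteq> v \<and> w \<noteq> u \<and> {v, u, w} \<in> T}"

definition nbrs :: "'v set set \<Rightarrow> 'v \<Rightarrow> 'v set" where
  "nbrs T v = {u. u \<noteq> v \<and> (\<exists>t\<in>T. {u, v} \<subseteq> t)}"

text \<open>The combinatorial data of a closed surface. By \<open>two\<close> and \<open>link_connected\<close> the link of each vertex is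
a cycle; \<open>two\<close> also says that each edge lies in exactly two triangles. Connectedness, of links and
of the whole complex, is expressed by the absence of proper nonempty subsets closed under
adjacency. The bound in \<open>degree\<close> is the one of the planar fan.\<close>

locale closed_triangulation =
  fixes V :: "'v set" and T :: "'v set set"
  assumes finV: "finite V" and V_ne: "V \<noteq> {}"
    and tri: "t \<in> T \<Longrightarrow> t \<subseteq> V \<and> card t = 3"
    and two: "v \<in> V \<Longrightarrow> u \<in> nbrs T v \<Longrightarrow> card (link_nbrs T v u) = 2"
    and link_connected: "\<lbrakk>v \<in> V; S \<subseteq> nbrs T v; S \<noteq> {}; \<And>u. u \<in> S \<Longrightarrow> link_nbrs T v u \<subseteq> S\<rbrakk>
           \<Longrightarrow> S = nbrs T v"
    and degree: "v \<in> V \<Longrightarrow> 4 \<le> card (nbrs T v)"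
    and connected: "\<lbrakk>S \<subseteq> V; S \<noteq> {}; \<And>u. u \<in> S \<Longrightarrow> nbrs T u \<subseteq> S\<rbrakk> \<Longrightarrow> S = V"
begin

definition simplices :: "'v set set" where
  "simplices = {S. \<exists>t\<in>T. S \<subseteq> t}"

definition edges :: "'v set set" where
  "edges = {e. card e = 2 \<and> (\<exists>t\<in>T. e \<subseteq> t)}"

lemma finT: "finite T"
  by (rule finite_subset[of T "Pow V"]) (use tri finV in auto)

lemma simplices_sub: "S \<in> simplices \<Longrightarrow> S \<subseteq> V"
  using tri by (auto simp: simplices_def)

lemma simplices_finite: "S \<in> simplices \<Longrightarrow> finite S"
  using simplices_sub finV finite_subset by blast

lemma finite_simplices: "finite simplices"
  by (rule finite_subset[of _ "Pow V"]) (use simplices_sub finV in auto)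

lemma simplices_card: "S \<in> simplices \<Longrightarrow> card S \<le> 3"
proof -
  assume "S \<in> simplices"
  then obtain t where t: "t \<in> T" "S \<subseteq> t" by (auto simp: simplices_def)
  then have "finite t" "card t = 3" using tri finV finite_subset by blast+
  then show "card S \<le> 3" using t card_mono by metis
qed

lemma simplices_mono: "S \<in> simplices \<Longrightarrow> R \<subseteq> S \<Longrightarrow> R \<in> simplices"
  by (auto simp: simplices_def)

lemma T_simplices: "t \<in> T \<Longrightarrow> t \<in> simplices"
  by (auto simp: simplices_def)

lemma edges_simplices: "e \<in> edges \<Longrightarrow> e \<in> simplices"
  by (auto simp: simplices_def edges_def)

lemma nbrs_sub: "v \<in> V \<Longrightarrow> nbrs T v \<subseteq> V"
  using tri by (auto simp: nbrs_def)

lemma vertex_simplex: "v \<in> V \<Longrightarrow> {v} \<in> simplices"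
proof -
  assume "v \<in> V"
  then have "nbrs T v \<noteq> {}" using degree by fastforce
  then show ?thesis by (auto simp: nbrs_def simplices_def)
qed

lemma link_nbrs_sub: "link_nbrs T v u \<subseteq> nbrs T v - {u}"
proof
  fix w assume "w \<in> link_nbrs T v u"
  then have w: "w \<noteq> v" "w \<noteq> u" "{v, u, w} \<in> T" by (simp_all add: link_nbrs_def)
  moreover have "{w, v} \<subseteq> {v, u, w}" by simp
  ultimately show "w \<in> nbrs T v - {u}" unfolding nbrs_def by blast
qed

lemma link_cycle:
  assumes v: "v \<in> V"
  obtains us where "distinct us" "set us = nbrs T v" "4 \<le> length us"
    "\<And>u w. \<lbrakk>u \<noteq> v; w \<noteq> v; w \<noteq> u\<rbrakk> \<Longrightarrow> {v, u, w} \<in> T \<longleftrightarrow>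
       (\<exists>i<length us. {u, w} = {us ! i, us ! (Suc i mod length us)})"
proof -
  have fin: "finite (nbrs T v)" using nbrs_sub[OF v] finV finite_subset by blast
  obtain x where x: "x \<in> nbrs T v" using degree[OF v] by fastforce
  have sym: "u \<in> link_nbrs T v w" if "w \<in> link_nbrs T v u" for u w
    using that by (auto simp: link_nbrs_def insert_commute)
  have "\<exists>us. distinct us \<and> set us = nbrs T v \<and> (\<forall>u\<in>nbrs T v. \<forall>w. w \<in> link_nbrs T v u \<longleftrightarrow>
        (\<exists>i<length us. {u, w} = {us ! i, us ! (Suc i mod length us)}))"
    by (rule two_regular_connected_cyclic_list[OF fin x two[OF v]])
      (use link_nbrs_sub[of v] sym link_connected[OF v] in simp_all)
  then obtain us where us: "distinct us" "set us = nbrs T v"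
    and cyc: "\<And>u w. u \<in> nbrs T v \<Longrightarrow> w \<in> link_nbrs T v u \<longleftrightarrow>
        (\<exists>i<length us. {u, w} = {us ! i, us ! (Suc i mod length us)})"
    by auto
  have len: "4 \<le> length us" using us degree[OF v] by (metis distinct_card)
  have "{v, u, w} \<in> T \<longleftrightarrow> (\<exists>i<length us. {u, w} = {us ! i, us ! (Suc i mod length us)})"
    if uw: "u \<noteq> v" "w \<noteq> v" "w \<noteq> u" for u w
  proof (cases "u \<in> nbrs T v")
    case True
    have "w \<in> link_nbrs T v u \<longleftrightarrow> {v, u, w} \<in> T" using uw by (simp add: link_nbrs_def)
    then show ?thesis using cyc[OF True, of w] by (rule subst)
  next
    case False
    have "{v, u, w} \<notin> T"
    proof
      assume "{v, u, w} \<in> T"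
      moreover have "{u, v} \<subseteq> {v, u, w}" by simp
      ultimately have "u \<in> nbrs T v" unfolding nbrs_def using uw(1) by blast
      then show False using False by contradiction
    qed
    moreover have "u \<noteq> us ! i \<and> u \<noteq> us ! (Suc i mod length us)" if "i < length us" for i
    proof -
      have "Suc i mod length us < length us" using that by (intro mod_less_divisor) auto
      then show ?thesis using us(2) that False nth_mem by metis
    qed
    then have "\<not> (\<exists>i<length us. {u, w} = {us ! i, us ! (Suc i mod length us)})"
      by (auto simp: doubleton_eq_iff)
    ultimately show ?thesis by blast
  qed
  then show thesis using that us len by blast
qed

lemma edge_triangle_count: "3 * card T = 2 * card edges"
proof -
  have finE: "finite edges"
    by (rule finite_subset[OF _ finite_simplices]) (use edges_simplices in blast)
  have per_edge: "card {t \<in> T. e \<subseteq> t} = 2" if "e \<in> edges" for e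
  proof -
    have "card e = 2" using that by (simp add: edges_def)
    then obtain u v where e: "e = {u, v}" "u \<noteq> v" unfolding card_2_iff by blast
    have uv: "v \<in> V" "u \<in> nbrs T v" using that e tri by (auto simp: edges_def nbrs_def)
    have "bij_betw (\<lambda>w. {v, u, w}) (link_nbrs T v u) {t \<in> T. e \<subseteq> t}"
    proof (rule bij_betwI')
      fix w w' assume "w \<in> link_nbrs T v u" "w' \<in> link_nbrs T v u"
      then show "{v, u, w} = {v, u, w'} \<longleftrightarrow> w = w'" by (auto simp: link_nbrs_def)
    next
      fix t assume t: "t \<in> {t \<in> T. e \<subseteq> t}"
      then have "card t = 3" using tri by blast
      then obtain x y z where xyz: "t = {x, y, z}" "x \<noteq> y" "x \<noteq> z" "y \<noteq> z"
        by (auto simp: card_3_iff)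
      then show "\<exists>w\<in>link_nbrs T v u. t = {v, u, w}"
        using t e by (auto simp: link_nbrs_def insert_commute)
    qed (auto simp: link_nbrs_def e)
    then show ?thesis using two[OF uv] bij_betw_same_card by metis
  qed
  have per_tri: "card {e \<in> edges. e \<subseteq> t} = 3" if "t \<in> T" for t
  proof -
    have "{e \<in> edges. e \<subseteq> t} = {e. e \<subseteq> t \<and> card e = 2}" using that by (auto simp: edges_def)
    moreover have "finite t" "card t = 3" using tri[OF that] finV finite_subset by blast+
    ultimately show ?thesis by (simp add: n_subsets choose_two)
  qed
  have "3 * card T = (\<Sum>t\<in>T. card {e \<in> edges. e \<subseteq> t})" by (simp add: per_tri)
  also have "\<dots> = (\<Sum>t\<in>T. \<Sum>e\<in>edges. if e \<subseteq> t then 1 else 0)"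
    using finE by (simp add: sum.If_cases Int_def)
  also have "\<dots> = (\<Sum>e\<in>edges. \<Sum>t\<in>T. if e \<subseteq> t then 1 else 0)" by (rule sum.swap)
  also have "\<dots> = (\<Sum>e\<in>edges. card {t \<in> T. e \<subseteq> t})"
    using finT by (simp add: sum.If_cases Int_def)
  also have "\<dots> = 2 * card edges" by (simp add: per_edge)
  finally show ?thesis .
qed

end

subsection \<open>Geometric realization\<close>

text \<open>Vertices are placed so that any six are affinely independent: two triangles have at most six
vertices, so the geometric simplices then meet only in common faces.\<close>

locale realized_triangulation = closed_triangulation V T for V :: "'v set" and T +
  fixes P :: "'v \<Rightarrow> 'a::euclidean_space"
  assumes injP: "inj_on P V"
    and general_position: "\<lbrakk>F \<subseteq> V; card F \<le> 6\<rbrakk> \<Longrightarrow> \<not> affine_dependent (P ` F)"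
begin

definition geo :: "'v set \<Rightarrow> 'a set" where
  "geo S = convex hull (P ` S)"

definition body :: "'a set" where
  "body = \<Union> (geo ` simplices)"

lemma geo_mono: "S \<subseteq> R \<Longrightarrow> geo S \<subseteq> geo R"
  unfolding geo_def by (intro hull_mono image_mono)

lemma compact_geo: "finite S \<Longrightarrow> compact (geo S)"
  by (simp add: geo_def finite_imp_compact_convex_hull)

lemma compact_body: "compact body"
  unfolding body_def using finite_simplices simplices_finite compact_geo by (intro compact_Union) auto

lemma barycentric_unique:
  assumes F: "F \<subseteq> V" "card F \<le> 6" and sums: "sum c F = sum c' F"
    and eq: "(\<Sum>u\<in>F. c u *\<^sub>R P u) = (\<Sum>u\<in>F. c' u *\<^sub>R P u)" and u: "u \<in> F"
  shows "c u = c' u"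
proof (rule ccontr)
  assume ne: "c u \<noteq> c' u"
  have finF: "finite F" using F finV finite_subset by blast
  have inj: "inj_on P F" using injP F inj_on_subset by blast
  define U where "U x = c (inv_into F P x) - c' (inv_into F P x)" for x
  have UP: "U (P w) = c w - c' w" if "w \<in> F" for w using inj that by (simp add: U_def)
  have "sum U (P ` F) = 0"
    using sums by (simp add: sum.reindex[OF inj] UP sum_subtractf)
  moreover have "(\<Sum>x\<in>P ` F. U x *\<^sub>R x) = 0"
    using eq by (simp add: sum.reindex[OF inj] UP sum_subtractf scaleR_diff_left)
  moreover have "U (P u) \<noteq> 0" using ne u UP by simp
  ultimately have "affine_dependent (P ` F)"
    using affine_dependent_explicit_finite[of "P ` F"] finF u by blast
  then show False using general_position F by blast
qed

lemma geo_iff: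
  assumes "F \<subseteq> V"
  shows "x \<in> geo F \<longleftrightarrow>
    (\<exists>c. (\<forall>u\<in>F. 0 \<le> c u) \<and> sum c F = 1 \<and> x = (\<Sum>u\<in>F. c u *\<^sub>R P u))"
proof -
  have finF: "finite F" using assms finV finite_subset by blast
  have inj: "inj_on P F" using injP assms inj_on_subset by blast
  show ?thesis
  proof
    assume "x \<in> geo F"
    then obtain k where k: "\<forall>y\<in>P ` F. 0 \<le> k y" "sum k (P ` F) = 1" "(\<Sum>y\<in>P ` F. k y *\<^sub>R y) = x"
      using convex_hull_finite[of "P ` F"] finF by (auto simp: geo_def)
    then show "\<exists>c. (\<forall>u\<in>F. 0 \<le> c u) \<and> sum c F = 1 \<and> x = (\<Sum>u\<in>F. c u *\<^sub>R P u)"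
      by (intro exI[of _ "k \<circ> P"]) (auto simp: sum.reindex[OF inj])
  next
    assume "\<exists>c. (\<forall>u\<in>F. 0 \<le> c u) \<and> sum c F = 1 \<and> x = (\<Sum>u\<in>F. c u *\<^sub>R P u)"
    then obtain c where c: "\<forall>u\<in>F. 0 \<le> c u" "sum c F = 1" "x = (\<Sum>u\<in>F. c u *\<^sub>R P u)" by blast
    have "P u \<in> geo F" if "u \<in> F" for u
      using that by (simp add: geo_def hull_inc)
    then show "x \<in> geo F"
      unfolding c(3) using c finF by (intro convex_sum) (auto simp: geo_def)
  qed
qed

lemma geo_Int:
  assumes "S \<in> simplices" "R \<in> simplices"
  shows "geo S \<inter> geo R = geo (S \<inter> R)"
proof -
  have sub: "S \<union> R \<subseteq> V" using assms simplices_sub by blast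
  have "card (S \<union> R) \<le> 6"
    using card_Un_le[of S R] simplices_card[OF assms(1)] simplices_card[OF assms(2)] by linarith
  then have "\<not> affine_dependent (P ` S \<union> P ` R)"
    using general_position[OF sub] by (simp add: image_Un)
  then show ?thesis
    unfolding geo_def
    using convex_hull_Int inj_on_image_Int[OF injP, of S R] sub by (metis Un_subset_iff)
qed

text \<open>A point of two simplices lies in the simplex spanned by their common vertices, so its coordinates
elsewhere vanish. All disjointness statements below reduce to this.\<close>

lemma barycentric_zero_outside:
  assumes S: "S \<in> simplices" and R: "R \<in> simplices"
    and c: "\<forall>u\<in>S. 0 \<le> c u" "sum c S = 1" and x: "(\<Sum>u\<in>S. c u *\<^sub>R P u) \<in> geo R"
    and u: "u \<in> S" "u \<notin> R"
  shows "c u = 0"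
proof -
  let ?x = "\<Sum>u\<in>S. c u *\<^sub>R P u"
  have finS: "finite S" and SV: "S \<subseteq> V" using S simplices_finite simplices_sub by blast+
  have "?x \<in> geo S" using geo_iff[OF SV] c by blast
  then have "?x \<in> geo (S \<inter> R)" using x geo_Int[OF S R] by blast
  then obtain k where k: "sum k (S \<inter> R) = 1" "?x = (\<Sum>u\<in>S \<inter> R. k u *\<^sub>R P u)"
    using geo_iff[of "S \<inter> R"] SV by blast
  define k' where "k' u = (if u \<in> R then k u else 0)" for u
  have "sum k' S = 1" using k finS by (simp add: k'_def sum.inter_restrict)
  moreover have "?x = (\<Sum>u\<in>S. k' u *\<^sub>R P u)"
    unfolding k(2) using finS by (simp add: k'_def sum.inter_restrict if_distrib[of "\<lambda>r. r *\<^sub>R _"] cong: if_cong)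
  ultimately have "c u = k' u"
    using barycentric_unique[OF SV, of c k' u] simplices_card[OF S] c u by simp
  then show ?thesis using u by (simp add: k'_def)
qed

lemma vertex_in_geo:
  assumes "v \<in> V" "S \<in> simplices" "P v \<in> geo S"
  shows "v \<in> S"
proof (rule ccontr)
  assume "v \<notin> S"
  then have "(\<lambda>_. 1 :: real) v = 0"
    using assms vertex_simplex by (intro barycentric_zero_outside[of "{v}" S]) auto
  then show False by simp
qed

lemma inj_geo: "inj_on geo simplices"
proof -
  have "S \<subseteq> R" if "S \<in> simplices" "R \<in> simplices" "geo S \<subseteq> geo R" for S R
  proof
    fix v assume v: "v \<in> S"
    then have "P v \<in> geo S" by (simp add: geo_def hull_inc)
    then show "v \<in> R" using vertex_in_geo that v simplices_sub by blast
  qed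
  then show ?thesis by (intro inj_onI) (metis order_refl subset_antisym)
qed

lemma independent_simplex: "S \<in> simplices \<Longrightarrow> \<not> affine_dependent (P ` S)"
  using general_position[of S] simplices_card[of S] simplices_sub by fastforce

lemma card_image_simplex: "S \<in> simplices \<Longrightarrow> card (P ` S) = card S"
  using injP simplices_sub by (metis card_image inj_on_subset)

lemma simplicial_complex_geo: "simplicial_complex (geo ` simplices)"
  unfolding simplicial_complex_def
proof (intro conjI allI impI ballI)
  show "finite (geo ` simplices)" using finite_simplices by simp
next
  fix X assume "X \<in> geo ` simplices"
  then obtain S where S: "S \<in> simplices" "X = geo S" by blast
  then show "\<exists>n. n simplex X"
    unfolding simplex_def geo_def using independent_simplex
    by (intro exI[of _ "int (card (P ` S)) - 1"] exI[of _ "P ` S"]) auto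
next
  fix F X assume "X \<in> geo ` simplices \<and> F face_of X"
  then obtain S where S: "S \<in> simplices" "F face_of convex hull (P ` S)" by (auto simp: geo_def)
  then obtain c where "c \<subseteq> P ` S" "F = convex hull c"
    using face_of_convex_hull_affine_independent[OF independent_simplex] by blast
  then obtain R where "R \<subseteq> S" "F = geo R" by (auto simp: subset_image_iff geo_def)
  then show "F \<in> geo ` simplices" using S simplices_mono by blast
next
  fix X Y assume "X \<in> geo ` simplices \<and> Y \<in> geo ` simplices"
  then obtain S R where S: "S \<in> simplices" "X = geo S" "R \<in> simplices" "Y = geo R" by blast
  then have "X \<inter> Y = convex hull (P ` (S \<inter> R))" using geo_Int by (simp add: geo_def)
  then show "X \<inter> Y face_of X"
    using S face_of_convex_hull_affine_independent[OF independent_simplex[OF S(1)]]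
    by (metis geo_def image_mono inf_le1)
qed

lemma euler_characteristic_sum:
  "(\<Sum>X \<in> geo ` simplices - {{}}. (- 1) ^ nat (aff_dim X)) = int (card V) - int (card edges) + int (card T)"
proof -
  have e0: "{} \<in> simplices" using V_ne vertex_simplex simplices_mono by blast
  have geo_empty: "geo S = {} \<longleftrightarrow> S = {}" for S by (simp add: geo_def)
  have "geo ` simplices - {{}} = geo ` (simplices - {{}})" using geo_empty by auto
  moreover have "inj_on geo (simplices - {{}})" using inj_geo inj_on_subset by blast
  ultimately have "(\<Sum>X \<in> geo ` simplices - {{}}. (- 1 :: int) ^ nat (aff_dim X)) =
      (\<Sum>S \<in> simplices - {{}}. (- 1) ^ nat (aff_dim (geo S)))"
    by (simp add: sum.reindex)
  also have "\<dots> = (\<Sum>S \<in> simplices - {{}}. (- 1) ^ (card S - 1))"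
  proof (rule sum.cong)
    fix S assume S: "S \<in> simplices - {{}}"
    then have "aff_dim (geo S) = int (card S) - 1"
      using aff_dim_affine_independent[OF independent_simplex] card_image_simplex
      by (simp add: geo_def aff_dim_convex_hull)
    then have "nat (aff_dim (geo S)) = card S - 1" by arith
    then show "(- 1 :: int) ^ nat (aff_dim (geo S)) = (- 1) ^ (card S - 1)" by simp
  qed simp
  also have "simplices - {{}} = (\<lambda>v. {v}) ` V \<union> (edges \<union> T)" (is "?L = ?R")
  proof
    show "?R \<subseteq> ?L"
      using vertex_simplex edges_simplices T_simplices tri by (fastforce simp: edges_def)
    show "?L \<subseteq> ?R"
    proof
      fix S assume S: "S \<in> ?L"
      then have fS: "finite S" and cS: "card S \<le> 3" and SV: "S \<subseteq> V"
        using simplices_finite simplices_card simplices_sub by blast+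
      then have "card S = 1 \<or> card S = 2 \<or> card S = 3" using S by (cases "card S") auto
      then consider "card S = 1" | "card S = 2" | "card S = 3" by blast
      then show "S \<in> ?R"
      proof cases
        case 1
        then show ?thesis using SV by (auto simp: card_1_singleton_iff)
      next
        case 2
        then show ?thesis using S by (auto simp: edges_def simplices_def)
      next
        case 3
        obtain t where "t \<in> T" "S \<subseteq> t" using S by (auto simp: simplices_def)
        then have "S = t" using 3 tri finV by (metis card_subset_eq finite_subset)
        then show ?thesis using \<open>t \<in> T\<close> by blast
      qed
    qed
  qed
  also have "(\<Sum>S \<in> (\<lambda>v. {v}) ` V \<union> (edges \<union> T). (- 1 :: int) ^ (card S - 1)) =
      (\<Sum>S \<in> (\<lambda>v. {v}) ` V. (- 1) ^ (card S - 1)) +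
      ((\<Sum>S \<in> edges. (- 1) ^ (card S - 1)) + (\<Sum>S \<in> T. (- 1) ^ (card S - 1)))"
  proof -
    have finE: "finite edges"
      by (rule finite_subset[OF _ finite_simplices]) (use edges_simplices in blast)
    have "edges \<inter> T = {}" using tri by (fastforce simp: edges_def)
    moreover have "(\<lambda>v. {v}) ` V \<inter> (edges \<union> T) = {}" using tri by (fastforce simp: edges_def)
    ultimately show ?thesis using finE finT finV by (simp add: sum.union_disjoint)
  qed
  also have "(\<Sum>S \<in> (\<lambda>v. {v}) ` V. (- 1 :: int) ^ (card S - 1)) = int (card V)"
    by (simp add: sum.reindex)
  also have "(\<Sum>S \<in> edges. (- 1 :: int) ^ (card S - 1)) = - int (card edges)"
    by (simp add: edges_def)
  also have "(\<Sum>S \<in> T. (- 1 :: int) ^ (card S - 1)) = int (card T)"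
    using tri by simp
  finally show ?thesis by simp
qed

end

subsection \<open>Manifold charts and connectedness\<close>

lemma homeomorphism_imp_homeomorphic_space:
  assumes "homeomorphism S R f g"
  shows "top_of_set S homeomorphic_space top_of_set R"
  using assms unfolding homeomorphic_space_def homeomorphic_maps_def homeomorphism_def
  by (intro exI[of _ f] exI[of _ g]) (auto simp: Pi_iff)

context realized_triangulation
begin

text \<open>The open star, as the complement of finitely many compact simplices, so that it is visibly open.\<close>

definition star :: "'v \<Rightarrow> 'a set" where
  "star v = body - \<Union> (geo ` {S \<in> simplices. v \<notin> S})"

lemma openin_star: "openin (top_of_set body) (star v)"
proof -
  have "closed (\<Union> (geo ` {S \<in> simplices. v \<notin> S}))"
    using finite_simplices simplices_finite compact_geo
    by (intro compact_imp_closed compact_Union) auto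
  then have "open (- \<Union> (geo ` {S \<in> simplices. v \<notin> S}))" by (rule open_Compl)
  moreover have "star v = body \<inter> - \<Union> (geo ` {S \<in> simplices. v \<notin> S})" by (auto simp: star_def)
  ultimately show ?thesis by (metis openin_open_Int)
qed

lemma in_starI:
  assumes S: "S \<in> simplices" and c: "\<forall>u\<in>S. 0 \<le> c u" "sum c S = 1" and v: "v \<in> S" "c v > 0"
  shows "(\<Sum>u\<in>S. c u *\<^sub>R P u) \<in> star v"
proof -
  have "(\<Sum>u\<in>S. c u *\<^sub>R P u) \<in> geo S" using geo_iff[OF simplices_sub[OF S]] c by blast
  moreover have "(\<Sum>u\<in>S. c u *\<^sub>R P u) \<notin> geo R" if "R \<in> simplices" "v \<notin> R" for R
    using barycentric_zero_outside[OF S that(1) c _ v(1) that(2)] v by auto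
  ultimately show ?thesis using S by (auto simp: star_def body_def)
qed

lemma body_covered_by_stars:
  assumes "x \<in> body"
  obtains v where "v \<in> V" "x \<in> star v"
proof -
  obtain S where S: "S \<in> simplices" "x \<in> geo S" using assms by (auto simp: body_def)
  obtain c where c: "\<forall>u\<in>S. 0 \<le> c u" "sum c S = 1" "x = (\<Sum>u\<in>S. c u *\<^sub>R P u)"
    using S geo_iff[OF simplices_sub[OF S(1)]] by blast
  have "\<exists>v\<in>S. c v > 0"
  proof (rule ccontr)
    assume "\<not> (\<exists>v\<in>S. c v > 0)"
    then have "sum c S \<le> 0" by (intro sum_nonpos) (simp add: not_less)
    then show False using c by simp
  qed
  then obtain v where v: "v \<in> S" "c v > 0" by blast
  then have "x \<in> star v" using in_starI[OF S(1) c(1,2)] c(3) by simp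
  then show ?thesis using that v simplices_sub S by blast
qed

text \<open>The triangles at \<open>v\<close> follow each other cyclically like the sectors of a planar fan. Using the fan
coordinates of \<open>z\<close> as barycentric coordinates at the link vertices, with the remaining weight on
\<open>v\<close>, gives a map \<open>\<psi>\<close> from the plane region \<open>\<sigma> z \<le> 1\<close> onto the closed star; uniqueness of barycentric
coordinates makes it injective, and compactness of the region makes its inverse continuous. The open
subregion \<open>\<sigma> z < 1\<close> consists of the points giving positive weight to \<open>v\<close>, which is the open star.\<close>

lemma star_homeomorphic_planar:
  assumes v: "v \<in> V"
  obtains W :: "complex set" where "open W" "top_of_set W homeomorphic_space top_of_set (star v)"
proof -
  obtain us where us: "distinct us" "set us = nbrs T v" "4 \<le> length us"
    and cyc: "\<And>u w. \<lbrakk>u \<noteq> v; w \<noteq> v; w \<noteq> u\<rbrakk> \<Longrightarrow> {v, u, w} \<in> T \<longleftrightarrow>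
       (\<exists>i<length us. {u, w} = {us ! i, us ! (Suc i mod length us)})"
    by (rule link_cycle[OF v]) blast
  define d where "d = length us"
  have d4: "4 \<le> d" using us by (simp add: d_def)
  obtain w :: "nat \<Rightarrow> complex" and s :: "nat \<Rightarrow> complex \<Rightarrow> real"
    where cont_s: "\<And>k. continuous_on UNIV (s k)" and norm_w: "\<And>k. norm (w k) = 1"
      and s_eq: "\<And>k i a b. \<lbrakk>k < d; i < d; 0 \<le> a; 0 \<le> b\<rbrakk> \<Longrightarrow>
         s k (of_real a * w i + of_real b * w (Suc i mod d)) =
           (if k = i then a else if k = Suc i mod d then b else 0)"
      and cover: "\<And>z. \<exists>i a b. i < d \<and> 0 \<le> a \<and> 0 \<le> b \<and>
           z = of_real a * w i + of_real b * w (Suc i mod d)"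
    by (rule complete_fan_complex[OF d4]) blast
  define nxt where "nxt i = Suc i mod d" for i
  have nxt: "nxt i < d" "nxt i \<noteq> i" if "i < d" for i
    using that d4 by (cases "Suc i = d"; simp add: nxt_def)+
  have us_nb: "us ! i \<in> nbrs T v" if "i < d" for i using us that by (metis d_def nth_mem)
  have us_v: "us ! i \<noteq> v" "us ! i \<in> V" if "i < d" for i
    using us_nb[OF that] nbrs_sub[OF v] by (auto simp: nbrs_def)
  have us_eq: "us ! i = us ! j \<longleftrightarrow> i = j" if "i < d" "j < d" for i j
    using us(1) that by (simp add: nth_eq_iff_index_eq d_def)
  have triT: "{v, us ! i, us ! nxt i} \<in> T" if "i < d" for i
    using cyc[of "us ! i" "us ! nxt i"] us_v nxt us_eq that by (auto simp: nxt_def d_def)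
  have two_terms: "(\<Sum>k<d. (if k = i then a else if k = nxt i then b else 0) *\<^sub>R h k) =
      a *\<^sub>R h i + b *\<^sub>R h (nxt i)" if "i < d" for i a b and h :: "nat \<Rightarrow> 'b::real_vector"
  proof -
    have "(\<Sum>k<d. (if k = i then a else if k = nxt i then b else 0) *\<^sub>R h k) =
        (\<Sum>k\<in>{i, nxt i}. (if k = i then a else if k = nxt i then b else 0) *\<^sub>R h k)"
      using nxt[OF that] that by (intro sum.mono_neutral_right) auto
    then show ?thesis using nxt[OF that] by auto
  qed
  define \<sigma> where "\<sigma> z = (\<Sum>k<d. s k z)" for z
  define \<psi> where "\<psi> z = (1 - \<sigma> z) *\<^sub>R P v + (\<Sum>k<d. s k z *\<^sub>R P (us ! k))" for z
  have repr: "\<exists>i a b. i < d \<and> 0 \<le> a \<and> 0 \<le> b \<and> z = of_real a * w i + of_real b * w (nxt i) \<and>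
      (\<forall>k<d. s k z = (if k = i then a else if k = nxt i then b else 0))" for z
    using cover[of z] s_eq unfolding nxt_def by blast
  have expand: "\<sigma> z = a + b \<and> \<psi> z = (1 - (a + b)) *\<^sub>R P v + a *\<^sub>R P (us ! i) + b *\<^sub>R P (us ! nxt i)"
    if "i < d" "\<forall>k<d. s k z = (if k = i then a else if k = nxt i then b else 0)" for z i a b
  proof -
    have "\<sigma> z = (\<Sum>k<d. (if k = i then a else if k = nxt i then b else 0) *\<^sub>R (1::real))"
      unfolding \<sigma>_def using that by (intro sum.cong) auto
    moreover have "(\<Sum>k<d. s k z *\<^sub>R P (us ! k)) =
        (\<Sum>k<d. (if k = i then a else if k = nxt i then b else 0) *\<^sub>R P (us ! k))"
      using that by (intro sum.cong) auto
    ultimately show ?thesis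
      unfolding \<psi>_def two_terms[OF that(1)] by (simp add: add.assoc)
  qed
  have z_eq: "z = (\<Sum>k<d. of_real (s k z) * w k)" for z
  proof -
    obtain i a b where i: "i < d" "z = of_real a * w i + of_real b * w (nxt i)"
      "\<forall>k<d. s k z = (if k = i then a else if k = nxt i then b else 0)" using repr by blast
    have "(\<Sum>k<d. of_real (s k z) * w k) =
        (\<Sum>k<d. (if k = i then a else if k = nxt i then b else 0) *\<^sub>R w k)"
      using i by (intro sum.cong) (auto simp: scaleR_conv_of_real)
    also have "\<dots> = z" using two_terms[OF i(1), of a b w] i(2) by (simp add: scaleR_conv_of_real)
    finally show ?thesis by simp
  qed
  have s_nonneg: "0 \<le> s k z" if "k < d" for k z
  proof -
    obtain i a b where "0 \<le> a" "0 \<le> b"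
      "\<forall>k<d. s k z = (if k = i then a else if k = nxt i then b else 0)" using repr by metis
    then show ?thesis using that by simp
  qed
  have cont_\<sigma>: "continuous_on UNIV \<sigma>"
    unfolding \<sigma>_def using cont_s by (intro continuous_on_sum) auto
  have cont_\<psi>: "continuous_on UNIV \<psi>"
    unfolding \<psi>_def using cont_s cont_\<sigma> by (intro continuous_intros) auto
  define D where "D = {z. \<sigma> z \<le> 1}"
  define W where "W = {z. \<sigma> z < 1}"
  have "open W"
    unfolding W_def by (rule open_Collect_less) (use cont_\<sigma> in auto)
  have "compact D"
  proof -
    have "closed D" unfolding D_def by (rule closed_Collect_le) (use cont_\<sigma> in auto)
    moreover have "norm z \<le> 1" if "z \<in> D" for z
    proof -
      have "norm z \<le> (\<Sum>k<d. norm (of_real (s k z) * w k))"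
        by (subst z_eq) (rule norm_sum)
      also have "\<dots> = \<sigma> z"
        unfolding \<sigma>_def by (intro sum.cong) (auto simp: norm_mult norm_w s_nonneg)
      finally show ?thesis using that by (simp add: D_def)
    qed
    then have "bounded D" by (auto simp: bounded_iff)
    ultimately show ?thesis by (simp add: compact_eq_bounded_closed)
  qed
  \<comment> \<open>The barycentric coordinates of \<open>\<psi> z\<close>, as a function on all vertices.\<close>
  define c where "c z u = (if u = v then 1 - \<sigma> z else \<Sum>k<d. if us ! k = u then s k z else 0)" for z u
  have c_us: "c z (us ! k) = s k z" if "k < d" for z k
  proof -
    have "c z (us ! k) = (\<Sum>j<d. if j = k then s j z else 0)"
      unfolding c_def using us_v[OF that] us_eq that by (auto intro!: sum.cong)
    then show ?thesis using that by simp
  qed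
  have \<psi>_c: "\<psi> z = (\<Sum>u\<in>F. c z u *\<^sub>R P u) \<and> sum (c z) F = 1"
    if F: "finite F" "{v, us ! i, us ! nxt i} \<subseteq> F" and i: "i < d"
      "\<forall>k<d. s k z = (if k = i then a else if k = nxt i then b else 0)" for F z i a b
  proof -
    let ?t = "{v, us ! i, us ! nxt i}"
    have zero: "c z u = 0" if "u \<in> F - ?t" for u
      using that i by (auto simp: c_def intro!: sum.neutral)
    have dist: "v \<noteq> us ! i" "v \<noteq> us ! nxt i" "us ! i \<noteq> us ! nxt i"
      using us_v nxt us_eq i(1) by metis+
    have vals: "c z v = 1 - (a + b)" "c z (us ! i) = a" "c z (us ! nxt i) = b"
      using c_us nxt[OF i(1)] i expand[OF i] by (auto simp: c_def)
    have "(\<Sum>u\<in>F. c z u *\<^sub>R P u) = (\<Sum>u\<in>?t. c z u *\<^sub>R P u)"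
      using F zero by (intro sum.mono_neutral_right) auto
    also have "\<dots> = \<psi> z" using dist vals expand[OF i] by (simp add: add.assoc)
    finally have 1: "\<psi> z = (\<Sum>u\<in>F. c z u *\<^sub>R P u)" by simp
    have "sum (c z) F = sum (c z) ?t"
      using F zero by (intro sum.mono_neutral_right) auto
    also have "\<dots> = 1" using dist vals by simp
    finally show ?thesis using 1 by blast
  qed
  have inj: "inj_on \<psi> D"
  proof (rule inj_onI)
    fix z z' assume eq: "\<psi> z = \<psi> z'"
    obtain i a b where i: "i < d"
      "\<forall>k<d. s k z = (if k = i then a else if k = nxt i then b else 0)" using repr[of z] by blast
    obtain i' a' b' where i': "i' < d"
      "\<forall>k<d. s k z' = (if k = i' then a' else if k = nxt i' then b' else 0)" using repr[of z'] by blast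
    define F where "F = {v, us ! i, us ! nxt i, us ! i', us ! nxt i'}"
    have F: "finite F" "{v, us ! i, us ! nxt i} \<subseteq> F" "{v, us ! i', us ! nxt i'} \<subseteq> F" "F \<subseteq> V"
      using us_v nxt i(1) i'(1) v by (auto simp: F_def)
    have "card F \<le> 6"
      using card_length[of "[v, us ! i, us ! nxt i, us ! i', us ! nxt i']"] by (simp add: F_def)
    then have same: "c z u = c z' u" if "u \<in> F" for u
      using barycentric_unique[OF F(4), of "c z" "c z'" u] that eq
        \<psi>_c[OF F(1,2) i] \<psi>_c[OF F(1,3) i'] by metis
    have "s k z = s k z'" if "k < d" for k
    proof (cases "us ! k \<in> F")
      case True
      then show ?thesis using same c_us that by metis
    next
      case False
      then have "k \<noteq> i" "k \<noteq> nxt i" "k \<noteq> i'" "k \<noteq> nxt i'" by (auto simp: F_def)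
      then show ?thesis using i(2) i'(2) that by simp
    qed
    then show "z = z'" using z_eq[of z] z_eq[of z'] by (metis (no_types, lifting) lessThan_iff sum.cong)
  qed
  have "\<psi> ` W = star v"
  proof
    show "\<psi> ` W \<subseteq> star v"
    proof (rule image_subsetI)
      fix z assume z: "z \<in> W"
      obtain i a b where i: "i < d" and ab: "0 \<le> a" "0 \<le> b" and sz:
        "\<forall>k<d. s k z = (if k = i then a else if k = nxt i then b else 0)" using repr[of z] by blast
      let ?t = "{v, us ! i, us ! nxt i}"
      have "\<forall>u\<in>?t. 0 \<le> c z u"
        using c_us s_nonneg nxt i z by (auto simp: c_def W_def)
      moreover have "c z v > 0" using z by (simp add: c_def W_def)
      ultimately show "\<psi> z \<in> star v"
        using in_starI[OF T_simplices[OF triT[OF i]], of "c z" v] \<psi>_c[OF _ order_refl i sz] by simp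
    qed
    show "star v \<subseteq> \<psi> ` W"
    proof
      fix x assume x: "x \<in> star v"
      then obtain S where "S \<in> simplices" "x \<in> geo S" by (auto simp: star_def body_def)
      then obtain t where t: "t \<in> T" "x \<in> geo t" using geo_mono by (auto simp: simplices_def)
      then have "v \<in> t" using x T_simplices by (auto simp: star_def)
      moreover have "card t = 3" using tri t by blast
      ultimately obtain u u' where uu: "t = {v, u, u'}" "u \<noteq> v" "u' \<noteq> v" "u' \<noteq> u"
        by (auto simp: card_3_iff insert_commute)
      then obtain i where i: "i < d" "{u, u'} = {us ! i, us ! nxt i}"
        using cyc[of u u'] t by (auto simp: d_def nxt_def)
      then have teq: "t = {v, us ! i, us ! nxt i}" using uu by auto
      have dist: "v \<noteq> us ! i" "v \<noteq> us ! nxt i" "us ! i \<noteq> us ! nxt i"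
        using us_v nxt us_eq i(1) by metis+
      obtain c' where c': "\<forall>u\<in>t. 0 \<le> c' u" "sum c' t = 1" "x = (\<Sum>u\<in>t. c' u *\<^sub>R P u)"
        using t geo_iff[OF simplices_sub[OF T_simplices]] by blast
      \<comment> \<open>Otherwise \<open>x\<close> would lie on the edge opposite \<open>v\<close>, outside the open star.\<close>
      have "c' v \<noteq> 0"
      proof
        assume c0: "c' v = 0"
        have "sum c' (t - {v}) = 1" "x = (\<Sum>u\<in>t - {v}. c' u *\<^sub>R P u)"
          using c' c0 dist by (simp_all add: teq)
        moreover have "t - {v} \<subseteq> V" using t tri by blast
        ultimately have "x \<in> geo (t - {v})" using geo_iff c' by (metis DiffD1)
        moreover have "t - {v} \<in> simplices" using t simplices_mono T_simplices by blast
        ultimately show False using x by (auto simp: star_def)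
      qed
      then have pos: "c' v > 0" using c' by (simp add: teq)
      define a where "a = c' (us ! i)"
      define b where "b = c' (us ! nxt i)"
      define z where "z = of_real a * w i + of_real b * w (nxt i)"
      have ab: "0 \<le> a" "0 \<le> b" using c' by (simp_all add: a_def b_def teq)
      have sz: "\<forall>k<d. s k z = (if k = i then a else if k = nxt i then b else 0)"
        using s_eq i ab by (simp add: z_def nxt_def)
      have one: "c' v + (a + b) = 1" using c'(2) dist by (simp add: teq a_def b_def)
      have "\<sigma> z < 1" using expand[OF i(1) sz] one pos by linarith
      moreover have "\<psi> z = x"
      proof -
        have "1 - (a + b) = c' v" using one by linarith
        then show ?thesis using expand[OF i(1) sz] c'(3) dist by (simp add: teq a_def b_def add.assoc)
      qed
      ultimately show "x \<in> \<psi> ` W" by (auto simp: W_def)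
    qed
  qed
  moreover obtain g where "homeomorphism D (\<psi> ` D) \<psi> g"
    using homeomorphism_compact[OF \<open>compact D\<close> _ refl inj] cont_\<psi> continuous_on_subset by blast
  moreover have "W \<subseteq> D" by (auto simp: W_def D_def)
  ultimately have "homeomorphism W (star v) \<psi> g"
    using homeomorphism_of_subsets[of D "\<psi> ` D" \<psi> g W "\<psi> ` D" "star v"] by blast
  then show thesis using that \<open>open W\<close> homeomorphism_imp_homeomorphic_space by blast
qed

lemma edge_geo: "geo {u, w} = closed_segment (P u) (P w)"
  by (simp add: geo_def segment_convex_hull)

lemma vertex_in_body: "v \<in> V \<Longrightarrow> P v \<in> body"
  unfolding body_def using vertex_simplex by (intro UN_I[of "{v}"]) (auto simp: geo_def)

lemma connected_body: "connected body"
proof -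
  obtain v0 where v0: "v0 \<in> V" using V_ne by blast
  define C where "C = connected_component_set body (P v0)"
  have geo_sub: "geo S \<subseteq> C" if "S \<in> simplices" "u \<in> S" "P u \<in> C" for S u
  proof -
    have "geo S \<subseteq> connected_component_set body (P u)"
      using that by (intro connected_component_maximal)
        (auto simp: geo_def body_def hull_inc intro: convex_connected)
    also have "\<dots> = C" using that(3) connected_component_eq by (fastforce simp: C_def)
    finally show ?thesis .
  qed
  have Pbody: "P u \<in> body" if "u \<in> V" for u
    using vertex_in_body that by blast
  have "{u \<in> V. P u \<in> C} = V"
  proof (rule connected)
    show "{u \<in> V. P u \<in> C} \<noteq> {}" using v0 Pbody by (auto simp: C_def)
    fix u assume u: "u \<in> {u \<in> V. P u \<in> C}"
    show "nbrs T u \<subseteq> {u \<in> V. P u \<in> C}"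
    proof
      fix w assume w: "w \<in> nbrs T u"
      then obtain t where t: "t \<in> T" "{w, u} \<subseteq> t" by (auto simp: nbrs_def)
      then have "geo t \<subseteq> C" using geo_sub[of t u] u T_simplices by blast
      moreover have "P w \<in> geo t" using t by (auto simp: geo_def intro: hull_inc)
      ultimately show "w \<in> {u \<in> V. P u \<in> C}" using w u nbrs_sub by blast
    qed
  qed blast
  then have all: "P u \<in> C" if "u \<in> V" for u using that by blast
  have "body \<subseteq> C"
  proof
    fix x assume "x \<in> body"
    then obtain S where S: "S \<in> simplices" "x \<in> geo S" by (auto simp: body_def)
    then have "S \<noteq> {}" by (auto simp: geo_def)
    then show "x \<in> C" using S geo_sub all simplices_sub by blast
  qed
  moreover have "C \<subseteq> body" by (simp add: C_def connected_component_subset)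
  ultimately show ?thesis by (metis C_def connected_connected_component subset_antisym)
qed

lemma surface_body: "surface (top_of_set body)"
  unfolding surface_def
proof (intro conjI ballI)
  obtain v where v: "v \<in> V" using V_ne by blast
  then show "topspace (top_of_set body) \<noteq> {}"
    using vertex_in_body by auto
  show "compact_space (top_of_set body)"
    using compact_body by (simp add: compact_space_subtopology)
  show "connected_space (top_of_set body)"
    using connected_body by (simp add: connected_space_subtopology)
  show "Hausdorff_space (top_of_set body)" by (simp add: Hausdorff_space_subtopology)
  have "second_countable (euclidean :: 'a topology)"
  proof -
    obtain B :: "'a set set" where B: "countable B" "topological_basis B"
      using ex_countable_basis by blast
    have "\<exists>C\<in>B. x \<in> C \<and> C \<subseteq> U" if "openin euclidean U \<and> x \<in> U" for U x
      using topological_basisE[OF B(2), of U x] that by (metis open_openin)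
    then show ?thesis
      unfolding second_countable_def using B topological_basis_open by (metis open_openin)
  qed
  then show "second_countable (top_of_set body)" by (rule second_countable_subtopology)
next
  fix x assume "x \<in> topspace (top_of_set body)"
  then obtain v where v: "v \<in> V" "x \<in> star v" using body_covered_by_stars by auto
  obtain W :: "complex set" where W: "open W" "top_of_set W homeomorphic_space top_of_set (star v)"
    using star_homeomorphic_planar[OF v(1)] by blast
  obtain h :: "complex \<Rightarrow> real^2" and k where hk: "linear h" "linear k"
      "\<And>z. k (h z) = z" "\<And>y. h (k y) = y"
    by (rule isomorphisms_UNIV_UNIV[where 'M=complex and 'N="real^2"]) auto
  have "surj h" using hk(4) by (metis surjI)
  then have "open (h ` W)" using open_surjective_linear_image[OF W(1) hk(1)] by blast
  moreover have "homeomorphism W (h ` W) h k"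
    using hk by (auto simp: homeomorphism_def image_image linear_continuous_on linear_linear)
  then have "top_of_set W homeomorphic_space top_of_set (h ` W)"
    by (rule homeomorphism_imp_homeomorphic_space)
  then have "top_of_set (star v) homeomorphic_space top_of_set (h ` W)"
    using W(2) homeomorphic_space_sym homeomorphic_space_trans by blast
  moreover have "subtopology (top_of_set body) (star v) = top_of_set (star v)"
    by (simp add: star_def subtopology_subtopology Int_absorb1 Diff_subset)
  ultimately show "\<exists>U. openin (top_of_set body) U \<and> x \<in> U \<and>
      (\<exists>W :: (real^2) set. open W \<and> subtopology (top_of_set body) U homeomorphic_space top_of_set W)"
    using openin_star v(2) by metis
qed

end

section \<open>Embedding the graph left after removing a vertex\<close>

context realized_triangulation
begin

lemma linepath_interior_in_geo:
  assumes uw: "{u, w} \<in> simplices" "u \<noteq> w" and t: "0 < t" "t < 1"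
    and R: "R \<in> simplices" "linepath (P u) (P w) t \<in> geo R"
  shows "u \<in> R \<and> w \<in> R"
proof -
  define c where "c z = (if z = u then 1 - t else t)" for z
  have eq: "linepath (P u) (P w) t = (\<Sum>z\<in>{u, w}. c z *\<^sub>R P z)"
    using uw by (simp add: linepath_def c_def)
  have c: "\<forall>z\<in>{u, w}. 0 \<le> c z" "sum c {u, w} = 1" using t uw by (auto simp: c_def)
  have "c u \<noteq> 0" "c w \<noteq> 0" using t uw by (auto simp: c_def)
  then show ?thesis
    using barycentric_zero_outside[OF uw(1) R(1) c] R(2) eq by auto
qed

text \<open>Every graph formed by edges of the triangulation that avoid \<open>v\<close> is drawn in the surface by straight
segments. A neighbour \<open>u\<close> of \<open>v\<close> is then a boundary point of the face containing \<open>v\<close>: the segment from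
\<open>v\<close> to \<open>u\<close> meets the drawing only in \<open>u\<close>, since its other points have positive weight at \<open>v\<close>. The labels
\<open>'l\<close> of the drawn graph are independent of the vertex type of the triangulation.\<close>

theorem removed_vertex_embedding:
  fixes N :: "'l set" and g :: "'l \<Rightarrow> 'v"
  assumes v: "v \<in> V" and gN: "g ` N \<subseteq> V - {v}" and inj: "inj_on g N"
    and E: "E \<subseteq> [N]\<^bsup>2\<^esup>" "\<And>e. e \<in> E \<Longrightarrow> g ` e \<in> simplices"
    and adj: "\<And>k. k \<in> N \<Longrightarrow> {v, g k} \<in> simplices"
  shows "\<exists>p \<gamma>. graph_embedding (top_of_set body) N E p \<gamma> \<and>
    (\<exists>F \<in> faces (top_of_set body) N E p \<gamma>. p ` N \<subseteq> top_of_set body frontier_of F)"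
proof -
  define p where "p = P \<circ> g"
  have gV: "g k \<in> V" "g k \<noteq> v" if "k \<in> N" for k using gN that by auto
  have pinj: "inj_on p N"
    unfolding p_def using inj injP gN by (intro comp_inj_on) (auto intro: inj_on_subset)
  have "\<exists>a b. e = {a, b} \<and> a \<noteq> b \<and> a \<in> N \<and> b \<in> N" if "e \<in> E" for e
  proof -
    have "card e = 2" "e \<subseteq> N" using E(1) that by (auto simp: nsets_def)
    then show ?thesis unfolding card_2_iff by blast
  qed
  then obtain a b where ab_eq: "\<And>e. e \<in> E \<Longrightarrow> e = {a e, b e}"
    and ab: "\<And>e. e \<in> E \<Longrightarrow> a e \<noteq> b e \<and> a e \<in> N \<and> b e \<in> N"
    by metis
  define \<gamma> where "\<gamma> e = linepath (p (a e)) (p (b e))" for e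
  have gab: "{g (a e), g (b e)} \<in> simplices" "g (a e) \<noteq> g (b e)" if "e \<in> E" for e
  proof -
    have "g ` e = g ` {a e, b e}" by (rule arg_cong[OF ab_eq[OF that]])
    then have "g ` e = {g (a e), g (b e)}" by simp
    then show "{g (a e), g (b e)} \<in> simplices" using E(2)[OF that] by simp
    show "g (a e) \<noteq> g (b e)" using ab[OF that] inj by (auto simp: inj_on_def)
  qed
  have interior: "g (a e) \<in> R \<and> g (b e) \<in> R"
    if "e \<in> E" "0 < t" "t < 1" "\<gamma> e t \<in> geo R" "R \<in> simplices" for e t R
    using linepath_interior_in_geo[OF gab[OF that(1)] that(2,3,5)] that(4) by (simp add: \<gamma>_def p_def)
  have \<gamma>_geo: "\<gamma> e ` {0..1} = geo {g (a e), g (b e)}" if "e \<in> E" for e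
    using edge_geo gV ab[OF that] linepath_image_01 by (metis \<gamma>_def p_def comp_apply)
  have p_geo: "p k \<in> geo {g k}" for k by (simp add: p_def geo_def)
  have emb: "graph_embedding (top_of_set body) N E p \<gamma>"
    unfolding graph_embedding_def
  proof (intro conjI ballI impI)
    show "p ` N \<subseteq> topspace (top_of_set body)" using vertex_in_body gV by (auto simp: p_def)
    show "inj_on p N" by (rule pinj)
  next
    fix e assume e: "e \<in> E"
    have "geo {g (a e), g (b e)} \<subseteq> body" using gab[OF e] by (auto simp: body_def)
    then show "pathin (top_of_set body) (\<gamma> e)"
      using \<gamma>_geo[OF e] by (auto simp: pathin_def \<gamma>_def continuous_map_in_subtopology)
    have "p (a e) \<noteq> p (b e)" using pinj ab[OF e] by (auto simp: inj_on_def)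
    then show "inj_on (\<gamma> e) {0..1}"
      using arc_linepath unfolding \<gamma>_def arc_def by blast
    have "p ` e = p ` {a e, b e}" by (rule arg_cong[OF ab_eq[OF e]])
    then show "{\<gamma> e 0, \<gamma> e 1} = p ` e" by (simp add: \<gamma>_def linepath_def)
    show "\<gamma> e ` {0<..<1} \<inter> p ` N = {}"
    proof (rule ccontr)
      assume "\<gamma> e ` {0<..<1} \<inter> p ` N \<noteq> {}"
      then obtain t k where t: "0 < t" "t < 1" "k \<in> N" "\<gamma> e t = p k" by auto
      then have "g (a e) \<in> {g k} \<and> g (b e) \<in> {g k}"
        using p_geo[of k] vertex_simplex gV by (intro interior[OF e]) auto
      then show False using gab(2)[OF e] by simp
    qed
  next
    fix e f assume e: "e \<in> E" and f: "f \<in> E" and ne: "e \<noteq> f"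
    show "\<gamma> e ` {0<..<1} \<inter> \<gamma> f ` {0<..<1} = {}"
    proof (rule ccontr)
      assume "\<gamma> e ` {0<..<1} \<inter> \<gamma> f ` {0<..<1} \<noteq> {}"
      then obtain t t' where t: "0 < t" "t < 1" "0 < t'" "t' < 1" "\<gamma> e t = \<gamma> f t'" by auto
      have "\<gamma> f t' \<in> \<gamma> f ` {0..1}" using t by simp
      then have "g (a e) \<in> {g (a f), g (b f)} \<and> g (b e) \<in> {g (a f), g (b f)}"
        using t gab(1)[OF f] \<gamma>_geo[OF f] by (intro interior[OF e]) auto
      then have "a e \<in> {a f, b f} \<and> b e \<in> {a f, b f}"
        using ab[OF e] ab[OF f] inj by (auto simp: inj_on_def)
      then have "{a e, b e} = {a f, b f}" using ab[OF e] by auto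
      then show False using ne ab_eq[OF e] ab_eq[OF f] by metis
    qed
  qed
  define G where "G = embedded_graph N E p \<gamma>"
  have G_avoids: "\<exists>R\<in>simplices. v \<notin> R \<and> x \<in> geo R" if x: "x \<in> G" for x
  proof -
    from x consider k where "k \<in> N" "x = p k" | e where "e \<in> E" "x \<in> \<gamma> e ` {0..1}"
      by (auto simp: G_def embedded_graph_def)
    then show ?thesis
    proof cases
      case 1
      then show ?thesis using p_geo[of k] vertex_simplex gV by (intro bexI[of _ "{g k}"]) auto
    next
      case 2
      then show ?thesis using \<gamma>_geo[OF 2(1)] gab[OF 2(1)] gV ab[OF 2(1)]
        by (intro bexI[of _ "{g (a e), g (b e)}"]) auto
    qed
  qed
  define Y where "Y = subtopology (top_of_set body) (topspace (top_of_set body) - G)"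
  have Y: "Y = top_of_set (body - G)"
    by (simp add: Y_def subtopology_subtopology Int_absorb1 Diff_subset)
  define F where "F = connected_component_of_set Y (P v)"
  have vG: "P v \<notin> G" using G_avoids vertex_in_geo v by blast
  have "F \<in> faces (top_of_set body) N E p \<gamma>"
    unfolding faces_def F_def G_def[symmetric] Y_def[symmetric]
    using connected_component_in_connected_components_of[of Y "P v"] vG vertex_in_body[OF v] Y by simp
  moreover have "p ` N \<subseteq> top_of_set body frontier_of F"
  proof (rule image_subsetI)
    fix k assume k: "k \<in> N"
    let ?l = "linepath (P v) (p k)"
    define S where "S = ?l ` {0..<1}"
    have seg: "{v, g k} \<in> simplices" "v \<noteq> g k" using adj gV k by blast+
    have l_body: "?l t \<in> body" if "0 \<le> t" "t \<le> 1" for t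
    proof -
      have "?l t \<in> closed_segment (P v) (p k)" using that linepath_in_path by force
      then show ?thesis using edge_geo[of v "g k"] v gV k seg by (auto simp: body_def p_def)
    qed
    have "?l t \<notin> G" if t: "0 \<le> t" "t < 1" for t
    proof
      assume "?l t \<in> G"
      then obtain R where R: "R \<in> simplices" "v \<notin> R" "?l t \<in> geo R" using G_avoids by blast
      show False
      proof (cases "t = 0")
        case True
        then show False using R vertex_in_geo v by (simp add: linepath_def)
      next
        case False
        then show False
          using linepath_interior_in_geo[OF seg _ t(2) R(1)] R t by (simp add: p_def)
      qed
    qed
    then have "S \<subseteq> body - G" using l_body by (auto simp: S_def)
    moreover have "connected S"
      unfolding S_def by (intro connected_continuous_image) auto
    ultimately have "connectedin Y S"
      by (simp add: Y connectedin_subtopology)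
    moreover have "P v \<in> S" unfolding S_def by (rule image_eqI[of _ _ 0]) (auto simp: linepath_def)
    ultimately have SF: "S \<subseteq> F" unfolding F_def by (rule connected_component_of_maximal)
    have "?l ` closure {0..<1} \<subseteq> closure S"
      unfolding S_def by (rule image_closure_subset) (auto simp: closure_subset)
    then have "?l 1 \<in> closure S" by (auto simp: image_subset_iff)
    then have cl: "p k \<in> closure S" by (simp add: linepath_def)
    have "p k \<in> top_of_set body closure_of F"
      unfolding in_closure_of
    proof (intro conjI allI impI)
      show "p k \<in> topspace (top_of_set body)" using vertex_in_body gV k by (simp add: p_def)
      fix U assume U: "p k \<in> U \<and> openin (top_of_set body) U"
      then obtain O' where O': "open O'" "U = body \<inter> O'" by (auto simp: openin_open)
      then have "O' \<inter> S \<noteq> {}" using cl U open_Int_closure_eq_empty[OF O'(1), of S] by blast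
      moreover have "S \<subseteq> body" using l_body by (auto simp: S_def)
      ultimately show "\<exists>y. y \<in> F \<and> y \<in> U" using O' SF by blast
    qed
    moreover have "p k \<notin> F"
    proof -
      have "p k \<in> G" using k by (simp add: G_def embedded_graph_def)
      moreover have "F \<subseteq> topspace Y" unfolding F_def by (rule connected_component_of_subset_topspace)
      ultimately show ?thesis using Y by auto
    qed
    ultimately show "p k \<in> top_of_set body frontier_of F"
      unfolding frontier_of_def using interior_of_subset by (metis Diff_iff in_mono)
  qed
  ultimately show ?thesis using emb by blast
qed

end

section \<open>Complete graphs minus a pentagon\<close>

text \<open>The complement of a pentagon is again a pentagon, so this is the join of a complete graph and a
5-cycle when \<open>a\<close>, \<open>b\<close>, \<open>c\<close>, \<open>d\<close>, \<open>e\<close> are distinct vertices.\<close>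

definition complete_minus_pentagon :: "'v set \<Rightarrow> 'v \<Rightarrow> 'v \<Rightarrow> 'v \<Rightarrow> 'v \<Rightarrow> 'v \<Rightarrow> 'v set set" where
  "complete_minus_pentagon N a b c d e = [N]\<^bsup>2\<^esup> - {{a, b}, {b, c}, {c, d}, {d, e}, {e, a}}"

text \<open>Among any three vertices of the pentagon two are consecutive, hence nonadjacent; so a clique misses at
least three vertices.\<close>

lemma pentagon_clique_bound:
  assumes fin: "finite N" and N: "{a, b, c, d, e} \<subseteq> N" and dist: "distinct [a, b, c, d, e]"
  shows "\<not> contains_complete N (complete_minus_pentagon N a b c d e) (card N - 2)"
proof
  assume "contains_complete N (complete_minus_pentagon N a b c d e) (card N - 2)"
  then obtain K where K: "K \<subseteq> N" "finite K" "card K = card N - 2"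
    and sub: "[K]\<^bsup>2\<^esup> \<subseteq> complete_minus_pentagon N a b c d e"
    unfolding contains_complete_def by blast
  have pair: "u \<notin> K \<or> w \<notin> K" if "{u, w} \<in> {{a, b}, {b, c}, {c, d}, {d, e}, {e, a}}" "u \<noteq> w" for u w
  proof (rule ccontr)
    assume "\<not> (u \<notin> K \<or> w \<notin> K)"
    then have "{u, w} \<in> [K]\<^bsup>2\<^esup>" using that by (simp add: nsets_def)
    then show False using sub that(1) unfolding complete_minus_pentagon_def by blast
  qed
  have "card ({a, b, c, d, e} - K) \<le> card (N - K)" using N fin by (intro card_mono) auto
  also have "\<dots> \<le> 2" using K fin by (simp add: card_Diff_subset)
  finally have "card ({a, b, c, d, e} - K) \<le> 2" .
  moreover have "card ({a, b, c, d, e} - K) = (\<Sum>x\<in>{a, b, c, d, e}. if x \<in> K then 0 else 1)"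
    by (simp add: sum.If_cases Diff_eq del: sum.insert)
  moreover have "\<dots> = (if a \<in> K then 0 else 1) + ((if b \<in> K then 0 else 1) + ((if c \<in> K then 0 else 1)
      + ((if d \<in> K then 0 else 1) + (if e \<in> K then 0 else 1))))"
    using dist by simp
  ultimately show False
    using pair[of a b] pair[of b c] pair[of c d] pair[of d e] pair[of e a] dist
    by (simp split: if_splits)
qed

text \<open>Give all vertices the same \<open>card N - 3\<close> colors. The vertices off the pentagon use up \<open>card N - 5\<close> of
them, none of which can recur on the pentagon; the two colors left do not suffice for the
complementary 5-cycle \<open>a\<close>, \<open>c\<close>, \<open>e\<close>, \<open>b\<close>, \<open>d\<close>.\<close>

lemma pentagon_not_list_colorable:
  assumes fin: "finite N" and N: "{a, b, c, d, e} \<subseteq> N" and dist: "distinct [a, b, c, d, e]"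
  shows "\<not> list_colorable (card N - 3) N (complete_minus_pentagon N a b c d e)"
proof
  let ?E = "complete_minus_pentagon N a b c d e"
  assume "list_colorable (card N - 3) N ?E"
  then obtain f where "list_colored N ?E (\<lambda>_. {0..<card N - 3}) f"
    unfolding list_colorable_def by (metis card_atLeastLessThan diff_zero finite_atLeastLessThan order_refl)
  then have col: "\<And>u. u \<in> N \<Longrightarrow> f u \<in> {0..<card N - 3}"
    and diff: "\<And>u w. u \<in> N \<Longrightarrow> w \<in> N \<Longrightarrow> {u, w} \<in> ?E \<Longrightarrow> f u \<noteq> f w"
    unfolding list_colored_def by auto
  define Q where "Q = {a, b, c, d, e}"
  have adj: "{u, w} \<in> ?E" if "u \<in> N" "w \<in> N" "u \<noteq> w"
    "{u, w} \<notin> {{a, b}, {b, c}, {c, d}, {d, e}, {e, a}}" for u w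
    using that by (simp add: complete_minus_pentagon_def nsets_def)
  have adjR: "f u \<noteq> f w" if "u \<in> N - Q" "w \<in> N" "u \<noteq> w" for u w
    using that by (intro diff adj) (auto simp: Q_def doubleton_eq_iff)
  have cardQ: "card Q = 5" using dist by (simp add: Q_def)
  have "Q \<subseteq> N" using N by (simp add: Q_def)
  then have N5: "5 \<le> card N" using fin cardQ card_mono by metis
  have "inj_on f (N - Q)" using adjR by (auto simp: inj_on_def)
  then have "card (f ` (N - Q)) = card N - 5"
    using cardQ \<open>Q \<subseteq> N\<close> fin by (simp add: card_image card_Diff_subset finite_subset)
  moreover have "f ` (N - Q) \<subseteq> {0..<card N - 3}" using col by blast
  ultimately have "card ({0..<card N - 3} - f ` (N - Q)) = 2"
    using N5 fin by (simp add: card_Diff_subset)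
  then obtain p q where pq: "{0..<card N - 3} - f ` (N - Q) = {p, q}" unfolding card_2_iff by blast
  have "f u \<in> {p, q}" if "u \<in> Q" for u
    unfolding pq[symmetric] using adjR[of _ u] col \<open>Q \<subseteq> N\<close> that by fastforce
  then have "f a \<in> {p, q}" "f b \<in> {p, q}" "f c \<in> {p, q}" "f d \<in> {p, q}" "f e \<in> {p, q}"
    by (simp_all add: Q_def)
  moreover have "f a \<noteq> f c" "f c \<noteq> f e" "f e \<noteq> f b" "f b \<noteq> f d" "f d \<noteq> f a"
    using N dist by (intro diff adj; auto simp: doubleton_eq_iff)+
  ultimately show False by auto
qed

section \<open>Graphs from near-complete triangulations\<close>

text \<open>The genus of a surface triangulated by \<open>K\<^sub>n\<close> minus an edge is just too small for \<open>K\<^sub>n\<close> itself: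
\<open>24 \<epsilon> + 1 = (2 n - 7)\<^sup>2 - 8\<close> lies between \<open>(2 n - 9)\<^sup>2\<close> and \<open>(2 n - 7)\<^sup>2\<close>.\<close>

lemma heawood_near_complete:
  assumes "6 * \<epsilon> + 2 = (n - 3) * (n - 4)" "5 \<le> n"
  shows "heawood \<epsilon> = n - 1"
proof -
  define x where "x = real n"
  have "real (6 * \<epsilon> + 2) = (x - 3) * (x - 4)"
    unfolding assms(1) x_def using assms(2) by (simp add: of_nat_diff)
  then have eq: "24 * real \<epsilon> + 1 = (2 * x - 7)\<^sup>2 - 8"
    by (simp add: power2_eq_square algebra_simps)
  have x5: "5 \<le> x" using assms(2) by (simp add: x_def)
  have "2 * x - 9 \<le> sqrt (24 * real \<epsilon> + 1)"
    unfolding eq using x5 by (intro real_le_rsqrt) (simp add: power2_eq_square algebra_simps)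
  moreover have "sqrt (24 * real \<epsilon> + 1) < 2 * x - 7"
    unfolding eq using x5 by (intro real_less_lsqrt) auto
  ultimately have "\<lfloor>(7 + sqrt (24 * real \<epsilon> + 1)) / 2\<rfloor> = int n - 1"
    by (intro floor_unique) (simp_all add: x_def)
  then show ?thesis by (simp add: heawood_def nat_diff_distrib)
qed

text \<open>If \<open>K\<^sub>n\<close> minus the edge \<open>x y\<close> triangulates a surface, Euler's formula makes \<open>\<epsilon>\<close> its genus. Any vertex
\<open>v\<close> other than \<open>x\<close> and \<open>y\<close> is adjacent to all others, so its removal puts the other \<open>n - 1\<close> vertices
on one face. The graph on them is complete up to the edge \<open>x y\<close>, and leaving out four more edges
turns it into a complete graph minus a pentagon.\<close>

theorem near_complete_triangulation_example:
  fixes V :: "'v set"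
  assumes "closed_triangulation V T"
    and xy: "x \<in> V" "y \<in> V" "x \<noteq> y" and no_xy: "\<And>t. t \<in> T \<Longrightarrow> \<not> {x, y} \<subseteq> t"
    and all: "\<And>u w. \<lbrakk>u \<in> V; w \<in> V; u \<noteq> w; {u, w} \<noteq> {x, y}\<rbrakk> \<Longrightarrow> \<exists>t\<in>T. {u, w} \<subseteq> t"
    and n: "card V = n" "6 \<le> n" and \<epsilon>: "6 * \<epsilon> + 2 = (n - 3) * (n - 4)"
  shows "\<exists>X :: (real^5) topology. surface X \<and> has_euler_genus X (int \<epsilon>) \<and>
      (\<exists>(V :: nat set) E. simple_graph V E \<and>
        (\<exists>p \<gamma>. graph_embedding X V E p \<gamma> \<and>
          (\<exists>F \<in> faces X V E p \<gamma>. p ` V \<subseteq> X frontier_of F)) \<and>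
        \<not> contains_complete V E (heawood \<epsilon> - 2) \<and>
        \<not> list_colorable (heawood \<epsilon> - 3) V E)"
proof -
  interpret closed_triangulation V T by fact
  obtain S :: "(real^5) set" where S: "infinite S"
    "\<And>F. \<lbrakk>F \<subseteq> S; finite F; card F \<le> 6\<rbrakk> \<Longrightarrow> \<not> affine_dependent F"
    using ex_infinite_general_position[where 'a = "real^5"] by auto
  obtain B where B: "B \<subseteq> S" "finite B" "card B = card V"
    using infinite_arbitrarily_large[OF S(1)] by blast
  obtain P where P: "bij_betw P V B" using finite_same_card_bij[OF finV B(2)] B(3) by auto
  interpret realized_triangulation V T P
  proof
    show "inj_on P V" using P by (simp add: bij_betw_def)
    fix F assume F: "F \<subseteq> V" "card F \<le> 6"
    then have "finite F" using finV finite_subset by blast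
    moreover have "P ` F \<subseteq> S" using P F B(1) by (auto simp: bij_betw_def)
    ultimately show "\<not> affine_dependent (P ` F)"
      using S(2) F(2) card_image_le[of F P] by (meson finite_imageI order_trans)
  qed
  have genus: "has_euler_genus (top_of_set body) (int \<epsilon>)"
  proof -
    have "edges = {e. e \<subseteq> V \<and> card e = 2} - {{x, y}}"
    proof
      show "edges \<subseteq> {e. e \<subseteq> V \<and> card e = 2} - {{x, y}}"
        using tri no_xy by (auto simp: edges_def)
      show "{e. e \<subseteq> V \<and> card e = 2} - {{x, y}} \<subseteq> edges"
      proof
        fix e assume e: "e \<in> {e. e \<subseteq> V \<and> card e = 2} - {{x, y}}"
        then have "card e = 2" by simp
        then obtain u w where "e = {u, w}" "u \<noteq> w" unfolding card_2_iff by blast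
        then show "e \<in> edges" using e all[of u w] by (simp add: edges_def)
      qed
    qed
    moreover have "card ({e. e \<subseteq> V \<and> card e = 2} - {{x, y}}) = card {e. e \<subseteq> V \<and> card e = 2} - 1"
      using xy by (intro card_Diff_singleton) auto
    moreover have "\<dots> = (n choose 2) - 1" using n_subsets[OF finV, of 2] n by simp
    moreover have "0 < n choose 2" using n by (intro zero_less_binomial) simp
    ultimately have "card edges + 1 = n choose 2" by (simp del: binomial_Suc_n)
    moreover have "even (n * (n - 1))" by auto
    ultimately have "2 * (card edges + 1) = n * (n - 1)"
      by (simp add: choose_two)
    then have "int (2 * (card edges + 1)) = int (n * (n - 1))" by (rule arg_cong)
    then have "2 * (int (card edges) + 1) = int n * (int n - 1)"
      using n(2) by (simp add: of_nat_diff)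
    moreover have "3 * int (card T) = 2 * int (card edges)" using edge_triangle_count by linarith
    moreover have "6 * int \<epsilon> + 2 = (int n - 3) * (int n - 4)"
      using arg_cong[OF \<epsilon>, of int] n(2) by (simp add: of_nat_diff)
    ultimately have "2 - int \<epsilon> = int (card V) - int (card edges) + int (card T)"
      using n(1) by (simp add: algebra_simps)
    then have "has_euler_characteristic (top_of_set body) (2 - int \<epsilon>)"
      unfolding has_euler_characteristic_def
      using simplicial_complex_geo euler_characteristic_sum
      by (intro exI[of _ "geo ` simplices"]) (simp add: body_def)
    then show ?thesis by (simp add: has_euler_genus_def)
  qed
  have "card (V - {x, y}) = n - 2" using n xy finV by (simp add: card_Diff_subset)
  then have "card (V - {x, y}) \<noteq> 0" using n by simp
  then have "V - {x, y} \<noteq> {}" by (metis card.empty)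
  then obtain v where v: "v \<in> V" "v \<noteq> x" "v \<noteq> y" by blast
  define N :: "nat set" where "N = {0..<n - 1}"
  have cardN: "card N = n - 1" "finite N" by (simp_all add: N_def)
  have "card (V - {v}) = n - 1" using v n by simp
  then obtain g where g: "bij_betw g N (V - {v})"
    unfolding N_def using ex_bij_betw_nat_finite[of "V - {v}"] finV by auto
  have gV: "g k \<in> V" "g k \<noteq> v" if "k \<in> N" for k using g that by (auto simp: bij_betw_def)
  have ginj: "inj_on g N" using g by (simp add: bij_betw_def)
  \<comment> \<open>Label the pentagon so that its edge \<open>e a\<close> is the missing edge \<open>x y\<close>.\<close>
  have "x \<in> g ` N" "y \<in> g ` N" using g xy v by (auto simp: bij_betw_def)
  then obtain a e where a: "a \<in> N" "g a = x" and e: "e \<in> N" "g e = y" by blast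
  have ae: "a \<noteq> e" using a e xy by auto
  have "3 \<le> card (N - {a, e})" using a e ae cardN n by (simp add: card_Diff_subset)
  then obtain M where M: "M \<subseteq> N - {a, e}" "card M = 3" using obtain_subset_with_card_n by metis
  then obtain b c d where bcd: "M = {b, c, d}" "b \<noteq> c" "b \<noteq> d" "c \<noteq> d"
    by (auto simp: card_3_iff)
  have five: "{a, b, c, d, e} \<subseteq> N" "distinct [a, b, c, d, e]" using M bcd a e ae by auto
  define E where "E = complete_minus_pentagon N a b c d e"
  have edge: "{u, w} \<in> simplices" if "u \<in> V" "w \<in> V" "u \<noteq> w" "{u, w} \<noteq> {x, y}" for u w
    using all[OF that] by (auto simp: simplices_def)
  have "g ` f \<in> simplices" if f: "f \<in> E" for f
  proof -
    have f2: "card f = 2" "f \<subseteq> N" and "f \<noteq> {e, a}"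
      using f by (auto simp: E_def complete_minus_pentagon_def nsets_def)
    obtain k l where kl: "f = {k, l}" "k \<noteq> l" using f2(1) unfolding card_2_iff by blast
    have "{g k, g l} \<noteq> {x, y}"
    proof
      assume "{g k, g l} = {x, y}"
      then have "g ` f = g ` {e, a}" using kl a e by (simp add: insert_commute)
      then have "f = {e, a}" using inj_on_image_eq_iff[OF ginj f2(2), of "{e, a}"] a(1) e(1) by blast
      then show False using \<open>f \<noteq> {e, a}\<close> by contradiction
    qed
    moreover have "g k \<noteq> g l" using kl f2 ginj by (auto simp: inj_on_def)
    ultimately show ?thesis using edge[of "g k" "g l"] kl f2 gV by auto
  qed
  moreover have "E \<subseteq> [N]\<^bsup>2\<^esup>" by (auto simp: E_def complete_minus_pentagon_def)
  moreover have "{v, g k} \<in> simplices" if "k \<in> N" for k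
    using edge[of v "g k"] gV[OF that] v by (auto simp: doubleton_eq_iff)
  moreover have "g ` N \<subseteq> V - {v}" using gV by blast
  ultimately have "\<exists>p \<gamma>. graph_embedding (top_of_set body) N E p \<gamma> \<and>
      (\<exists>F \<in> faces (top_of_set body) N E p \<gamma>. p ` N \<subseteq> top_of_set body frontier_of F)"
    using removed_vertex_embedding[OF v(1) _ ginj] by blast
  moreover have H: "heawood \<epsilon> = n - 1" using heawood_near_complete \<epsilon> n by simp
  moreover have "heawood \<epsilon> - 2 = card N - 2" "heawood \<epsilon> - 3 = card N - 3"
    using H cardN by simp_all
  moreover have "simple_graph N E"
    using \<open>E \<subseteq> [N]\<^bsup>2\<^esup>\<close> cardN by (simp add: simple_graph_def)
  ultimately show ?thesis
    using surface_body genus pentagon_clique_bound[OF cardN(2) five]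
      pentagon_not_list_colorable[OF cardN(2) five]
    unfolding E_def by (metis (no_types, lifting))
qed

section \<open>A near-complete triangulation with cyclic symmetry\<close>

text \<open>The shape of a vertex link. \<open>M k\<close>, \<open>U k\<close> and \<open>D k\<close> stand for membership, in a set closed under link
adjacency, of three link vertices indexed by \<open>k\<close> modulo \<open>m\<close>, and \<open>X\<close> and \<open>Y\<close> stand for that of the
poles. \<open>M k\<close> is joined to \<open>U k\<close> and \<open>D k\<close>, except
that the index \<open>j\<close> is the central vertex itself and has no \<open>M j\<close>. The \<open>U\<close>-vertices are joined in pairs
by the reflection \<open>k \<mapsto> - k\<close>, the \<open>D\<close>-vertices by \<open>k \<mapsto> - 1 - k\<close>. The composition of the two
reflections is a step by one, so walking alternately up and down leads from the fixed point \<open>0\<close> of the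
first through \<open>-1, 1, -2, 2, \<dots>\<close> to the fixed point \<open>r\<close> of the second. The poles are joined to the
two ends of this path and to the two sides of the gap. The gap at \<open>j\<close> cuts this path
in two. As \<open>0 \<le> j \<le> r\<close>, the part before the gap runs from \<open>Y\<close> to \<open>X\<close> and so does the part after it, which
closes the link to a single cycle; for a gap at a negative index each part would close up
separately.\<close>

lemma dihedral_walk:
  fixes M U D :: "int \<Rightarrow> bool" and m r j :: int
  assumes m: "m = 2 * r + 1" and j: "0 \<le> j" "j \<le> r"
    and MU: "\<And>k. \<not> m dvd k - j \<Longrightarrow> M k = U k" and MD: "\<And>k. \<not> m dvd k - j \<Longrightarrow> M k = D k"
    and UU: "\<And>k. U (- k) = U k" and DD: "\<And>k. D (- 1 - k) = D k"
    and ends: "U 0 = Y" "D r = X" "U j = X" "D j = Y"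
  shows "X = Y" "\<And>k. \<lbrakk>- r \<le> k; k \<le> r\<rbrakk> \<Longrightarrow> U k = X \<and> D k = X \<and> (k \<noteq> j \<longrightarrow> M k = X)"
proof -
  have ndvd: "\<not> m dvd k - j" if "- r - 1 \<le> k" "k \<le> r" "k \<noteq> j" "k + m \<noteq> j" "k \<noteq> j + m" for k
  proof
    assume "m dvd k - j"
    then obtain c where c: "k - j = m * c" by blast
    have "\<bar>k - j\<bar> < 2 * m" using that m j by auto
    then have "m * \<bar>c\<bar> < m * 2" using m j unfolding c by (simp add: abs_mult)
    moreover have "0 < m" using m j by simp
    ultimately have "\<bar>c\<bar> < 2" by (simp only: mult_less_cancel_left_pos)
    then have "c = -1 \<or> c = 0 \<or> c = 1" by linarith
    then show False using c that by auto
  qed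
  have UD: "U k = D k" if "- r - 1 \<le> k" "k \<le> r" "k \<noteq> j" "k + m \<noteq> j" "k \<noteq> j + m" for k
    using MU MD ndvd[OF that] by metis
  \<comment> \<open>From the fixed point \<open>0\<close> up to the gap, and from the fixed point \<open>r\<close> down to the gap.\<close>
  have low: "U (int n) = Y" if "int n \<le> j" for n
    using that
  proof (induction n)
    case (Suc n)
    have "U (int n) = D (int n)" using Suc.prems j m by (intro UD) auto
    also have "\<dots> = D (- 1 - int n)" by (simp add: DD)
    also have "\<dots> = U (- 1 - int n)" using Suc.prems j m by (intro UD[symmetric]) auto
    also have "\<dots> = U (int (Suc n))" using UU[of "int (Suc n)"] by (simp add: algebra_simps)
    finally show ?case using Suc by simp
  qed (simp add: ends)
  have high: "D (r - int n) = X" if "j \<le> r - int n" for n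
    using that
  proof (induction n)
    case (Suc n)
    let ?k = "r - int n"
    have "D ?k = U ?k" using Suc.prems j m by (intro UD[symmetric]) auto
    also have "\<dots> = U (- ?k)" by (rule UU[symmetric])
    also have "\<dots> = D (- ?k)" using Suc.prems j m by (intro UD) auto
    also have "\<dots> = D (r - int (Suc n))" using DD[of "?k - 1"] by (simp add: algebra_simps)
    finally show ?case using Suc by simp
  qed (simp add: ends)
  have "U j = Y" using low[of "nat j"] j by simp
  then show XY: "X = Y" using ends by simp
  have U0: "U k = X \<and> D k = X" if "0 \<le> k" "k \<le> r" for k
  proof -
    consider "k < j" | "k = j" | "k > j" by linarith
    then show ?thesis
    proof cases
      case 1
      then have "U k = X" using low[of "nat k"] that XY by simp
      then show ?thesis using UD[of k] 1 that j m by auto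
    next
      case 3
      then have "D k = X" using high[of "nat (r - k)"] that by simp
      then show ?thesis using UD[of k] 3 that j m by auto
    qed (use ends XY in simp)
  qed
  fix k assume k: "- r \<le> k" "k \<le> r"
  have "U k = X" using U0[of k] U0[of "- k"] UU[of k] k by (cases "0 \<le> k") auto
  moreover have "D k = X" using U0[of k] U0[of "- 1 - k"] DD[of k] k j by (cases "0 \<le> k") auto
  moreover have "M k = U k" if "k \<noteq> j" using MU ndvd[of k] k that j m by auto
  ultimately show "U k = X \<and> D k = X \<and> (k \<noteq> j \<longrightarrow> M k = X)" by blast
qed

text \<open>The vertices are three copies of the integers modulo \<open>m\<close>, arranged cyclically, and two poles.
\<open>nx True\<close> is the step to the next layer and \<open>nx False\<close> the step back.\<close>

datatype layer = L0 | L1 | L2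

fun nx :: "bool \<Rightarrow> layer \<Rightarrow> layer" where
  "nx True L0 = L1" | "nx True L1 = L2" | "nx True L2 = L0"
| "nx False L0 = L2" | "nx False L1 = L0" | "nx False L2 = L1"

lemma nx_ne [simp]: "nx s i \<noteq> i" "i \<noteq> nx s i"
  by (cases s; cases i; simp)+

lemma nx_nx [simp]: "nx (\<not> s) (nx s i) = i" "nx s (nx (\<not> s) i) = i"
  by (cases s; cases i; simp)+

lemma nx_inj [simp]: "nx s i = nx s' i \<longleftrightarrow> s = s'"
  by (cases s; cases s'; cases i; simp)

lemma layer_cases: obtains "j = i" | s where "j = nx s i"
proof (cases "j = i")
  case False
  then have "j = nx True i \<or> j = nx False i" by (cases i; cases j; simp)
  then show thesis using that by blast
qed (use that in blast)

lemma UNIV_layer: "UNIV = {L0, L1, L2}"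
  using layer.exhaust by auto

datatype vtx = Pole bool | Pt layer int

text \<open>The offsets of the triangles of each sort. Only three combinations matter: the sums over the layers,
\<open>1\<close> and \<open>- 1\<close>, make the links of the poles single cycles, and the sums \<open>0\<close>, \<open>- q\<close>, \<open>q\<close> of the
\<open>True\<close>-offset of a layer and the \<open>False\<close>-offset of the next one make the links of the other vertices
single cycles.\<close>

fun shift :: "int \<Rightarrow> bool \<Rightarrow> layer \<Rightarrow> int" where
  "shift q True i = (if i = L0 then 1 else 0)"
| "shift q False i = (case i of L0 \<Rightarrow> q | L1 \<Rightarrow> - 1 | L2 \<Rightarrow> - q)"

declare shift.simps [simp del]

text \<open>For either sort \<open>s\<close> there is one triangle for every pair of points \<open>x\<close>, \<open>y\<close> in a layer: its third vertex
lies in the layer \<open>nx s i\<close> at the midpoint of \<open>x\<close> and \<open>y\<close>, shifted by \<open>- c s i\<close>. For \<open>x = y\<close> the pole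
\<open>s\<close> takes the place of \<open>y\<close>. Division by two is possible since \<open>m\<close> is odd, and \<open>h\<close> is the inverse of 2
modulo \<open>m\<close>. All triangles are invariant under translation modulo \<open>m\<close>.\<close>

locale layered_triangulation =
  fixes q :: int
  assumes q: "1 \<le> q"
begin

definition m :: int where "m = 4 * q + 1"
definition h :: int where "h = 2 * q + 1"

abbreviation c where "c \<equiv> shift q"

definition pt :: "layer \<Rightarrow> int \<Rightarrow> vtx" where
  "pt i x = Pt i (x mod m)"

text \<open>
The triangles are parametrized by one base point \<open>x\<close> and the apex \<open>z\<close>, so that no division is
needed; \<open>opp\<close> gives the other base vertex.\<close>

definition opp :: "bool \<Rightarrow> layer \<Rightarrow> int \<Rightarrow> int \<Rightarrow> vtx" where
  "opp s i x y = (if m dvd x - y then Pole s else pt i y)"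

definition tri :: "bool \<Rightarrow> layer \<Rightarrow> int \<Rightarrow> int \<Rightarrow> vtx set" where
  "tri s i x z = {pt i x, opp s i x (2 * (z + c s i) - x), pt (nx s i) z}"

definition V :: "vtx set" where
  "V = range Pole \<union> (\<Union>i. range (pt i))"

definition T :: "vtx set set" where
  "T = {tri s i x z | s i x z. True}"

lemma m_pos: "0 < m" using q by (simp add: m_def)

lemma two_h: "2 * h = m + 1" by (simp add: m_def h_def)

lemma pt_eq_iff: "pt i x = pt j y \<longleftrightarrow> i = j \<and> m dvd x - y"
  by (auto simp: pt_def mod_eq_dvd_iff)

lemma pt_eqI: "x = y + m * k \<Longrightarrow> pt i x = pt i y"
  by (simp add: pt_def)

lemma pt_ne_Pole [simp]: "pt i x \<noteq> Pole s" "Pole s \<noteq> pt i x"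
  by (simp_all add: pt_def)

lemma dvd_double: "m dvd 2 * a \<longleftrightarrow> m dvd a"
proof
  assume "m dvd 2 * a"
  then have "m dvd h * (2 * a) - m * a" using dvd_diff[OF dvd_mult dvd_triv_left] by blast
  also have "h * (2 * a) - m * a = a" using two_h by (simp add: m_def h_def algebra_simps)
  finally show "m dvd a" .
qed simp

lemma dvd_add_multiple: "m dvd a + m * b \<longleftrightarrow> m dvd a"
  by (rule dvd_add_left_iff) simp

lemma opp_cong:
  assumes "m dvd x - x'" "m dvd y - y'"
  shows "opp s i x y = opp s i x' y'"
proof -
  have "m dvd (x - y) - (x' - y')" using dvd_diff[OF assms] by (simp add: algebra_simps)
  then have "m dvd x - y \<longleftrightarrow> m dvd x' - y'" using dvd_diffD1 dvd_diff by (metis diff_add_cancel dvd_add_right_iff)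
  then show ?thesis using assms by (simp add: opp_def pt_eq_iff)
qed

lemma tri_cong:
  assumes "m dvd x - x'" "m dvd z - z'"
  shows "tri s i x z = tri s i x' z'"
proof -
  have "m dvd 2 * (z - z') - (x - x')" by (rule dvd_diff[OF dvd_mult[OF assms(2)] assms(1)])
  then have "opp s i x (2 * (z + c s i) - x) = opp s i x' (2 * (z' + c s i) - x')"
    by (intro opp_cong) (use assms in \<open>auto simp: algebra_simps\<close>)
  moreover have "pt i x = pt i x'" "pt (nx s i) z = pt (nx s i) z'"
    using assms by (simp_all add: pt_eq_iff)
  ultimately show ?thesis by (simp only: tri_def)
qed

lemma opp_swap:
  assumes "pt i y = opp s i x (2 * (z + c s i) - x)"
  shows "opp s i y (2 * (z + c s i) - y) = pt i x"
proof -
  let ?y = "2 * (z + c s i) - x"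
  have nd: "\<not> m dvd x - ?y" and yy: "m dvd y - ?y"
    using assms by (auto simp: opp_def pt_eq_iff split: if_splits)
  have 1: "m dvd 2 * (z + c s i) - y - x" using yy by (simp add: algebra_simps dvd_diff_commute)
  have "opp s i y (2 * (z + c s i) - y) = opp s i ?y x"
    using yy 1 by (intro opp_cong) auto
  also have "\<dots> = pt i x"
    unfolding opp_def using nd dvd_diff_commute[of m x ?y] by (intro if_not_P) blast
  finally show ?thesis .
qed

lemma tri_swap:
  assumes "pt i y = opp s i x (2 * (z + c s i) - x)"
  shows "tri s i x z = tri s i y z"
  using opp_swap[OF assms] assms by (auto simp: tri_def)

lemma opp_ne: "pt i x \<noteq> opp s i x y" "i \<noteq> j \<Longrightarrow> pt j z \<noteq> opp s i x y"
  by (auto simp: opp_def pt_eq_iff)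

lemma card_tri: "card (tri s i x z) = 3"
proof -
  have "pt i x \<noteq> pt (nx s i) z" by (simp add: pt_eq_iff)
  then show ?thesis
    using opp_ne(1)[of i x s] opp_ne(2)[of i "nx s i" z s x] by (simp add: tri_def eq_commute[of "opp _ _ _ _"])
qed

lemma tri_in_T: "tri s i x z \<in> T" by (auto simp: T_def)

lemma pt_in_V: "pt i x \<in> V" by (auto simp: V_def)

lemma Pole_in_V: "Pole s \<in> V" by (auto simp: V_def)

lemma opp_in_V: "opp s i x y \<in> V" by (auto simp: V_def opp_def)

lemma V_cases: assumes "v \<in> V" obtains s where "v = Pole s" | i x where "v = pt i x"
  using assms by (auto simp: V_def)

lemma T_sub: "t \<in> T \<Longrightarrow> t \<subseteq> V \<and> card t = 3"
  using card_tri pt_in_V opp_in_V by (auto simp: T_def) (auto simp: tri_def)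

lemma finite_card_V: "finite V" "card V = nat (12 * q + 5)"
proof -
  have r: "range (pt i) = Pt i ` {0..<m}" for i
  proof
    show "range (pt i) \<subseteq> Pt i ` {0..<m}" using m_pos by (auto simp: pt_def)
    show "Pt i ` {0..<m} \<subseteq> range (pt i)"
    proof
      fix v assume "v \<in> Pt i ` {0..<m}"
      then obtain x where "v = Pt i x" "0 \<le> x" "x < m" by auto
      then have "v = pt i x" by (simp add: pt_def)
      then show "v \<in> range (pt i)" by blast
    qed
  qed
  have V: "V = {Pole True, Pole False} \<union> (Pt L0 ` {0..<m} \<union> (Pt L1 ` {0..<m} \<union> Pt L2 ` {0..<m}))"
    unfolding V_def r UNIV_layer UNIV_bool by auto
  then show "finite V" by simp
  have "card (Pt i ` {0..<m}) = nat m" for i by (simp add: card_image inj_on_def)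
  moreover have "Pt i ` {0..<m} \<inter> Pt j ` {0..<m} = {}" if "i \<noteq> j" for i j using that by auto
  ultimately have "card V = 2 + (nat m + (nat m + nat m))"
    unfolding V by (subst card_Un_disjoint; auto)+
  then show "card V = nat (12 * q + 5)" using q by (simp add: m_def nat_add_distrib flip: nat_mult_distrib)
qed

text \<open>A point \<open>pt i x\<close> is a base vertex of a triangle, or its apex.\<close>

lemma triangle_at_pt:
  assumes "u \<noteq> pt i x" "w \<noteq> pt i x"
  shows "{pt i x, u, w} \<in> T \<longleftrightarrow>
    (\<exists>s z. {u, w} = {opp s i x (2 * (z + c s i) - x), pt (nx s i) z}) \<or>
    (\<exists>s y. {u, w} = {pt (nx (\<not> s) i) y,
        opp s (nx (\<not> s) i) y (2 * (x + c s (nx (\<not> s) i)) - y)})"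
    (is "_ \<longleftrightarrow> ?base \<or> ?apex")
proof
  have cancel: "{u, w} = {a, b}" if "{pt i x, u, w} = {pt i x, a, b}" "a \<noteq> pt i x" "b \<noteq> pt i x" for a b
    using that assms by (metis insert_ident insertE singletonD)
  assume "{pt i x, u, w} \<in> T"
  then obtain s j y z where t: "{pt i x, u, w} = tri s j y z" by (auto simp: T_def)
  have base: "?base" if "{pt i x, u, w} = tri s i x z" for s z
  proof -
    have "{u, w} = {opp s i x (2 * (z + c s i) - x), pt (nx s i) z}"
      using that opp_ne(1)[of i x s] by (intro cancel) (auto simp: tri_def pt_eq_iff eq_commute[of "opp _ _ _ _"])
    then show ?thesis by blast
  qed
  have "pt i x \<in> tri s j y z" using t by blast
  then consider "pt i x = pt j y" | "pt i x = opp s j y (2 * (z + c s j) - y)" | "pt i x = pt (nx s j) z"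
    by (auto simp: tri_def)
  then show "?base \<or> ?apex"
  proof cases
    case 1
    then have "tri s j y z = tri s i x z"
      using tri_cong[of y x z z] by (simp add: pt_eq_iff dvd_diff_commute)
    then show ?thesis using base t by simp
  next
    case 2
    then have ij: "i = j" by (auto simp: opp_def pt_eq_iff split: if_splits)
    then have "tri s j y z = tri s i x z" using tri_swap 2 by metis
    then show ?thesis using base t by simp
  next
    case 3
    then have ij: "i = nx s j" "j = nx (\<not> s) i" and "m dvd z - x"
      by (auto simp: pt_eq_iff dvd_diff_commute)
    then have "tri s j y z = tri s j y x" using tri_cong[of y y z x] by simp
    then have "{pt i x, u, w} = {pt i x, pt j y, opp s j y (2 * (x + c s j) - y)}"
      using t ij(1) by (auto simp: tri_def)
    then have "{u, w} = {pt j y, opp s j y (2 * (x + c s j) - y)}"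
      using ij(1) opp_ne(2)[of j i x s] by (intro cancel) (auto simp: pt_eq_iff eq_commute[of "opp _ _ _ _"])
    then show ?thesis unfolding ij(2) by blast
  qed
next
  assume "?base \<or> ?apex"
  then show "{pt i x, u, w} \<in> T"
  proof
    assume ?base
    then obtain s z where "{u, w} = {opp s i x (2 * (z + c s i) - x), pt (nx s i) z}" by blast
    then have "{pt i x, u, w} = tri s i x z" by (simp add: tri_def)
    then show ?thesis by (simp add: tri_in_T)
  next
    assume ?apex
    then obtain s y where "{u, w} = {pt (nx (\<not> s) i) y,
        opp s (nx (\<not> s) i) y (2 * (x + c s (nx (\<not> s) i)) - y)}" by blast
    then have "{pt i x, u, w} = tri s (nx (\<not> s) i) y x" by (auto simp: tri_def)
    then show ?thesis by (simp add: tri_in_T)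
  qed
qed

text \<open>The third vertices of the triangles at an edge, for the three kinds of edges; in each case there are
two. Two points of a layer have a midpoint in the next and in the previous layer.\<close>

lemma link_pt_same_layer:
  assumes "\<not> m dvd x - y"
  shows "link_nbrs T (pt i x) (pt i y) =
    {pt (nx True i) (h * (x + y) - c True i), pt (nx False i) (h * (x + y) - c False i)}"
proof -
  have ne: "pt i y \<noteq> pt i x" using assms by (simp add: pt_eq_iff dvd_diff_commute)
  have double: "2 * (h * (x + y) - c s i + c s i) - x = y + m * (x + y)" for s
    using two_h by (simp add: m_def h_def algebra_simps)
  have "w \<in> link_nbrs T (pt i x) (pt i y) \<longleftrightarrow> (\<exists>s. w = pt (nx s i) (h * (x + y) - c s i))" for w
  proof
    assume "w \<in> link_nbrs T (pt i x) (pt i y)"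
    then have w: "w \<noteq> pt i x" "w \<noteq> pt i y" "{pt i x, pt i y, w} \<in> T"
      by (simp_all add: link_nbrs_def)
    then consider s z where "{pt i y, w} = {opp s i x (2 * (z + c s i) - x), pt (nx s i) z}"
      | s y' where "{pt i y, w} = {pt (nx (\<not> s) i) y', opp s (nx (\<not> s) i) y' (2 * (x + c s (nx (\<not> s) i)) - y')}"
      using triangle_at_pt[OF ne w(1)] by blast
    then show "\<exists>s. w = pt (nx s i) (h * (x + y) - c s i)"
    proof cases
      case 1
      then have 2: "pt i y = opp s i x (2 * (z + c s i) - x)" "w = pt (nx s i) z"
        by (auto simp: doubleton_eq_iff pt_eq_iff)
      then have "m dvd y - (2 * (z + c s i) - x)" by (auto simp: opp_def pt_eq_iff split: if_splits)
      then have "m dvd h * (y - (2 * (z + c s i) - x)) + m * (z + c s i)"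
        using dvd_add[OF dvd_mult dvd_triv_left] by blast
      also have "\<dots> = (h * (x + y) - c s i) - z"
        using two_h by (simp add: m_def h_def algebra_simps)
      finally show ?thesis using 2 by (auto simp: pt_eq_iff dvd_diff_commute)
    next
      case 2
      then show ?thesis by (auto simp: doubleton_eq_iff pt_eq_iff opp_def split: if_splits)
    qed
  next
    assume "\<exists>s. w = pt (nx s i) (h * (x + y) - c s i)"
    then obtain s where w: "w = pt (nx s i) (h * (x + y) - c s i)" by blast
    let ?z = "h * (x + y) - c s i"
    have "opp s i x (2 * (?z + c s i) - x) = opp s i x y"
      unfolding double by (intro opp_cong) auto
    also have "\<dots> = pt i y" using assms by (simp add: opp_def)
    finally have "{pt i x, pt i y, w} = tri s i x ?z" by (simp add: tri_def w)
    then show "w \<in> link_nbrs T (pt i x) (pt i y)"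
      using ne tri_in_T by (simp add: link_nbrs_def w pt_eq_iff)
  qed
  then show ?thesis by (auto simp: set_eq_iff) (metis (full_types))+
qed

lemma link_pt_next_layer:
  "link_nbrs T (pt i x) (pt (nx s i) z) =
    {opp s i x (2 * (z + c s i) - x), opp (\<not> s) (nx s i) z (2 * (x + c (\<not> s) (nx s i)) - z)}"
    (is "?L = {?a, ?b}")
proof -
  let ?u = "pt (nx s i) z"
  have ne: "?u \<noteq> pt i x" by (simp add: pt_eq_iff)
  have t: "{pt i x, ?u, ?a} = tri s i x z" "{pt i x, ?u, ?b} = tri (\<not> s) (nx s i) z x"
    by (auto simp: tri_def)
  have "?a \<noteq> pt i x" "?a \<noteq> ?u" "?b \<noteq> pt i x" "?b \<noteq> ?u"
    using opp_ne by (metis nx_ne)+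
  then have sup: "{?a, ?b} \<subseteq> ?L" using t tri_in_T ne by (simp add: link_nbrs_def)
  have "w = ?a \<or> w = ?b" if "w \<in> ?L" for w
  proof -
    have w: "w \<noteq> pt i x" "w \<noteq> ?u" "{pt i x, ?u, w} \<in> T" using that by (simp_all add: link_nbrs_def)
    then consider s' z' where "{?u, w} = {opp s' i x (2 * (z' + c s' i) - x), pt (nx s' i) z'}"
      | s' y where "{?u, w} = {pt (nx (\<not> s') i) y, opp s' (nx (\<not> s') i) y (2 * (x + c s' (nx (\<not> s') i)) - y)}"
      using triangle_at_pt[OF ne w(1)] by blast
    then show ?thesis
    proof cases
      case 1
      then have 2: "?u = pt (nx s' i) z'" "w = opp s' i x (2 * (z' + c s' i) - x)"
        by (auto simp: doubleton_eq_iff pt_eq_iff opp_def split: if_splits)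
      then have "s' = s" "m dvd z' - z" by (auto simp: pt_eq_iff dvd_diff_commute)
      moreover have "m dvd (2 * (z' + c s i) - x) - (2 * (z + c s i) - x)"
        using \<open>m dvd z' - z\<close> dvd_double[of "z' - z"] by (simp add: algebra_simps)
      ultimately show ?thesis using 2 opp_cong[of x x] by auto
    next
      case 2
      let ?j = "nx (\<not> s') i" and ?r = "\<lambda>y. 2 * (x + c s' (nx (\<not> s') i)) - y"
      from 2 consider "?u = pt ?j y" "w = opp s' ?j y (?r y)" | "?u = opp s' ?j y (?r y)" "w = pt ?j y"
        by (auto simp: doubleton_eq_iff)
      then show ?thesis
      proof cases
        case 1
        then have s: "s' = (\<not> s)" "m dvd y - z" by (auto simp: pt_eq_iff dvd_diff_commute)
        then have "w = opp s' ?j z (?r z)"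
          unfolding 1(2) by (intro opp_cong) (auto simp: dvd_diff_commute)
        then show ?thesis using s by simp
      next
        case 2
        then have s: "s' = (\<not> s)" by (auto simp: pt_eq_iff opp_def split: if_splits)
        then have "w = opp s' ?j z (?r z)" using 2 opp_swap[of ?j z s' y x] by simp
        then show ?thesis using s by simp
      qed
    qed
  qed
  then show ?thesis using sup by blast
qed

lemma link_pt_Pole:
  "link_nbrs T (pt i x) (Pole s) =
    {pt (nx s i) (x - c s i), pt (nx (\<not> s) i) (x + c s (nx (\<not> s) i))}" (is "?L = {?a, ?b}")
proof -
  let ?j = "nx (\<not> s) i"
  have ne: "Pole s \<noteq> pt i x" by simp
  have "{pt i x, Pole s, ?a} = tri s i x (x - c s i)" by (simp add: tri_def opp_def)
  moreover have "{pt i x, Pole s, ?b} = tri s ?j (x + c s ?j) x"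
    by (simp add: tri_def opp_def insert_commute)
  ultimately have sup: "{?a, ?b} \<subseteq> ?L"
    using tri_in_T by (auto simp: link_nbrs_def pt_eq_iff)
  have "w = ?a \<or> w = ?b" if "w \<in> ?L" for w
  proof -
    have w: "w \<noteq> pt i x" "{pt i x, Pole s, w} \<in> T" using that by (simp_all add: link_nbrs_def)
    then consider s' z' where "{Pole s, w} = {opp s' i x (2 * (z' + c s' i) - x), pt (nx s' i) z'}"
      | s' y where "{Pole s, w} = {pt (nx (\<not> s') i) y, opp s' (nx (\<not> s') i) y (2 * (x + c s' (nx (\<not> s') i)) - y)}"
      using triangle_at_pt[OF ne w(1)] by blast
    then show ?thesis
    proof cases
      case 1
      then have 2: "Pole s = opp s' i x (2 * (z' + c s' i) - x)" "w = pt (nx s' i) z'"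
        by (auto simp: doubleton_eq_iff)
      then have s: "s' = s" and "m dvd 2 * (x - c s i - z')"
        by (auto simp: opp_def algebra_simps split: if_splits)
      then have "m dvd (x - c s i) - z'" by (simp only: dvd_double)
      then have "?a = w" unfolding 2(2) s pt_eq_iff by blast
      then show ?thesis by simp
    next
      case 2
      then have 2: "Pole s = opp s' (nx (\<not> s') i) y (2 * (x + c s' (nx (\<not> s') i)) - y)" "w = pt (nx (\<not> s') i) y"
        by (auto simp: doubleton_eq_iff)
      then have s: "s' = s" and "m dvd 2 * (y - (x + c s ?j))"
        by (auto simp: opp_def algebra_simps split: if_splits)
      then have "m dvd y - (x + c s ?j)" by (simp only: dvd_double)
      then have "w = ?b" unfolding 2(2) s pt_eq_iff by blast
      then show ?thesis by simp
    qed
  qed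
  then show ?thesis using sup by blast
qed

lemma no_triangle_at_both_poles: "t \<in> T \<Longrightarrow> \<not> {Pole True, Pole False} \<subseteq> t"
  by (auto simp: T_def tri_def) (metis vtx.inject(1))

lemma link_nbrs_commute: "link_nbrs T u v = link_nbrs T v u"
  by (auto simp: link_nbrs_def insert_commute)

lemma link_card:
  assumes "u \<in> V" "v \<in> V" "u \<noteq> v" "{u, v} \<noteq> {Pole True, Pole False}"
  shows "card (link_nbrs T v u) = 2"
proof -
  have pt: "card (link_nbrs T (pt i x) w) = 2" if "w \<in> V" "w \<noteq> pt i x" for i x w
    using \<open>w \<in> V\<close>
  proof (cases rule: V_cases)
    case (1 s)
    then show ?thesis by (simp add: link_pt_Pole pt_eq_iff)
  next
    case (2 j y)
    show ?thesis
    proof (cases rule: layer_cases[of j i])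
      case 1
      then have "\<not> m dvd x - y" using 2 that by (simp add: pt_eq_iff dvd_diff_commute)
      then show ?thesis using link_pt_same_layer 1 2 by (simp add: pt_eq_iff)
    next
      case (2 s)
      have "opp s i x a \<noteq> opp (\<not> s) (nx s i) y b" for a b by (auto simp: opp_def pt_eq_iff)
      then show ?thesis using 2 \<open>w = pt j y\<close> by (simp add: link_pt_next_layer)
    qed
  qed
  from assms(2) show ?thesis
  proof (cases rule: V_cases)
    case (1 s)
    from assms(1) show ?thesis
    proof (cases rule: V_cases)
      case (1 s')
      then show ?thesis using assms \<open>v = Pole s\<close> by (cases s; cases s'; auto)
    next
      case (2 i x)
      then show ?thesis using pt[of v i x] assms link_nbrs_commute by metis
    qed
  next
    case (2 i x)
    then show ?thesis using pt assms by blast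
  qed
qed

lemma edge_in_triangle:
  assumes "u \<in> V" "v \<in> V" "u \<noteq> v" "{u, v} \<noteq> {Pole True, Pole False}"
  shows "\<exists>t\<in>T. {u, v} \<subseteq> t"
proof -
  have "link_nbrs T v u \<noteq> {}" using link_card[OF assms] by auto
  then obtain w where "{v, u, w} \<in> T" by (auto simp: link_nbrs_def)
  then show ?thesis by (intro bexI[of _ "{v, u, w}"]) simp_all
qed

lemma nbrs_pt: "nbrs T (pt i x) = V - {pt i x}"
proof
  show "nbrs T (pt i x) \<subseteq> V - {pt i x}" using T_sub by (fastforce simp: nbrs_def)
  show "V - {pt i x} \<subseteq> nbrs T (pt i x)"
    using edge_in_triangle[OF _ pt_in_V] by (auto simp: nbrs_def doubleton_eq_iff)
qed

lemma nbrs_Pole: "nbrs T (Pole s) = V - range Pole"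
proof
  show "nbrs T (Pole s) \<subseteq> V - range Pole"
  proof
    fix u assume "u \<in> nbrs T (Pole s)"
    then obtain t where t: "t \<in> T" "{u, Pole s} \<subseteq> t" "u \<noteq> Pole s" by (auto simp: nbrs_def)
    have "u \<noteq> Pole s'" for s'
      using no_triangle_at_both_poles[OF t(1)] t by (cases s; cases s'; auto)
    then show "u \<in> V - range Pole" using t T_sub by blast
  qed
  show "V - range Pole \<subseteq> nbrs T (Pole s)"
  proof
    fix u assume u: "u \<in> V - range Pole"
    then have "\<exists>t\<in>T. {u, Pole s} \<subseteq> t"
      by (intro edge_in_triangle) (auto simp: V_def doubleton_eq_iff)
    then show "u \<in> nbrs T (Pole s)" using u by (auto simp: nbrs_def)
  qed
qed

text \<open>Let \<open>a = c True i + c False (nx True i)\<close> and \<open>b = c False i + c True (nx False i)\<close>. The link of a point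
of layer \<open>i\<close> is governed by the reflections \<open>d \<mapsto> 4 a - d\<close> and \<open>d \<mapsto> 4 b - d\<close> of the offsets \<open>d\<close> from
that point. Substituting \<open>d = (k - j) * G\<close> for a unit \<open>G\<close>, with inverse \<open>G'\<close>, turns them into
\<open>k \<mapsto> - k\<close> and \<open>k \<mapsto> - 1 - k\<close> exactly when the last two congruences hold. In the layer \<open>L2\<close> they force
\<open>4 j\<close> to be \<open>- 1\<close> modulo \<open>m\<close>, and for \<open>m = 4 q + 1\<close> the solution \<open>j = q\<close> lies in the required range.\<close>

lemma layer_parameters:
  obtains j G G' where "0 \<le> j" "j \<le> 2 * q" "m dvd G * G' - 1"
    "m dvd 4 * (c True i + c False (nx True i)) + 2 * j * G"
    "m dvd 4 * (c False i + c True (nx False i)) + (2 * j + 1) * G"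
proof (cases i)
  case L0
  show ?thesis by (rule that[of 0 1 1]) (use q L0 in \<open>simp_all add: shift.simps m_def\<close>)
next
  case L1
  show ?thesis by (rule that[of "2 * q" 1 1]) (use q L1 in \<open>simp_all add: shift.simps m_def\<close>)
next
  case L2
  have "- 2 * - h - 1 = m * 1" using two_h by simp
  moreover have "4 * (c False i + c True (nx False i)) + (2 * q + 1) * - 2 = m * - 2"
    using L2 by (simp add: shift.simps m_def)
  moreover have "4 * (c True i + c False (nx True i)) + 2 * q * - 2 = m * 0"
    using L2 by (simp add: shift.simps)
  ultimately show ?thesis using q by (intro that[of q "- 2" "- h"]) (simp_all only: dvd_triv_left)
qed

text \<open>The link of \<open>pt i x\<close> contains, for every offset \<open>d\<close>, the apices \<open>A True d\<close> and \<open>A False d\<close> over the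
midpoint of \<open>x\<close> and \<open>x + d\<close>. An apex \<open>A s d\<close> is joined to \<open>pt i (x + d)\<close>, and also to the apex that has
\<open>pt i x\<close> as its mirror image in the adjacent layer, which is \<open>A s (4 * a s - d)\<close>. So the link is the one
analysed in \<open>dihedral_walk\<close>, with \<open>U = A True\<close> and \<open>D = A False\<close> after rescaling.\<close>

lemma link_connected_pt:
  assumes S: "S \<subseteq> nbrs T (pt i x)" "S \<noteq> {}"
    and closed: "\<And>u. u \<in> S \<Longrightarrow> link_nbrs T (pt i x) u \<subseteq> S"
  shows "S = nbrs T (pt i x)"
proof -
  have step: "u \<in> S \<longleftrightarrow> w \<in> S"
    if "{pt i x, u, w} \<in> T" "u \<noteq> pt i x" "w \<noteq> pt i x" "u \<noteq> w" for u w
  proof -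
    have "w \<in> link_nbrs T (pt i x) u" "u \<in> link_nbrs T (pt i x) w"
      using that by (auto simp: link_nbrs_def insert_commute)
    then show ?thesis using closed by blast
  qed
  define A where "A s d = pt (nx s i) (x + h * d - c s i)" for s d
  define a where "a s = c s i + c (\<not> s) (nx s i)" for s
  have A_cong: "A s d = A s d'" if "m dvd d - d'" for s d d'
  proof -
    have "m dvd h * (d - d')" using that by (rule dvd_mult)
    then show ?thesis by (simp add: A_def pt_eq_iff algebra_simps)
  qed
  have A_ne: "A s d \<noteq> pt i y" "A s d \<noteq> Pole s'" for s s' d y by (simp_all add: A_def pt_eq_iff)
  have mid: "pt i (x + d) \<in> S \<longleftrightarrow> A s d \<in> S" if d: "\<not> m dvd d" for s d
  proof (rule step)
    let ?z = "x + h * d - c s i"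
    have "2 * (?z + c s i) - x = x + d + m * d"
      using two_h by (simp add: m_def h_def algebra_simps)
    then have "opp s i x (2 * (?z + c s i) - x) = opp s i x (x + d)"
      by (intro opp_cong) auto
    also have "\<dots> = pt i (x + d)" using d by (simp add: opp_def)
    finally have "tri s i x ?z = {pt i x, pt i (x + d), A s d}" by (simp add: tri_def A_def)
    then show "{pt i x, pt i (x + d), A s d} \<in> T" using tri_in_T by metis
    show "pt i (x + d) \<noteq> pt i x" using d by (simp add: pt_eq_iff)
    show "A s d \<noteq> pt i x" "pt i (x + d) \<noteq> A s d" using A_ne by metis+
  qed
  have apex: "{pt i x, A s d, opp (\<not> s) (nx s i) (x + h * d - c s i)
      (2 * (x + c (\<not> s) (nx s i)) - (x + h * d - c s i))} \<in> T" for s d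
  proof -
    have "{pt i x, A s d, opp (\<not> s) (nx s i) (x + h * d - c s i)
      (2 * (x + c (\<not> s) (nx s i)) - (x + h * d - c s i))} =
      tri (\<not> s) (nx s i) (x + h * d - c s i) x" by (auto simp: tri_def A_def)
    then show ?thesis using tri_in_T by simp
  qed
  have gap: "(x + h * d - c s i) - (2 * (x + c (\<not> s) (nx s i)) - (x + h * d - c s i)) =
      (d - 2 * a s) + m * d" for s d
    using two_h by (simp add: a_def m_def h_def algebra_simps)
  have partner: "pt (nx s i) (2 * (x + c (\<not> s) (nx s i)) - (x + h * d - c s i)) = A s (4 * a s - d)" for s d
  proof -
    have "2 * (x + c (\<not> s) (nx s i)) - (x + h * d - c s i) =
        (x + h * (4 * a s - d) - c s i) + m * (- 2 * a s)"
      using two_h by (simp add: a_def m_def h_def algebra_simps)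
    then show ?thesis unfolding A_def by (rule pt_eqI)
  qed
  have partner_or_pole: "opp (\<not> s) (nx s i) (x + h * d - c s i)
      (2 * (x + c (\<not> s) (nx s i)) - (x + h * d - c s i)) =
      (if m dvd d - 2 * a s then Pole (\<not> s) else A s (4 * a s - d))" for s d
    unfolding opp_def gap partner dvd_add_multiple by (rule refl)
  have reflect: "A s d \<in> S \<longleftrightarrow> A s (4 * a s - d) \<in> S" for s d
  proof (cases "m dvd d - 2 * a s")
    case True
    have "d - (4 * a s - d) = 2 * (d - 2 * a s)" by simp
    then have "A s d = A s (4 * a s - d)" using True by (intro A_cong) (simp only: dvd_double)
    then show ?thesis by simp
  next
    case False
    then have "{pt i x, A s d, A s (4 * a s - d)} \<in> T"
      using apex[of s d] unfolding partner_or_pole by simp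
    moreover have "A s d \<noteq> A s (4 * a s - d)"
    proof
      assume "A s d = A s (4 * a s - d)"
      then have "m dvd 2 * (h * (d - 2 * a s))" by (simp add: A_def pt_eq_iff algebra_simps)
      then have "m dvd h * (d - 2 * a s)" by (simp only: dvd_double)
      then have "m dvd 2 * (h * (d - 2 * a s))" by (rule dvd_mult)
      moreover have "2 * (h * (d - 2 * a s)) = (d - 2 * a s) + m * (d - 2 * a s)"
        using two_h by (simp add: m_def h_def algebra_simps)
      ultimately have "m dvd d - 2 * a s" by (simp only: dvd_add_multiple)
      then show False using False by contradiction
    qed
    ultimately show ?thesis using A_ne by (intro step) auto
  qed
  have fixed: "A s d \<in> S \<longleftrightarrow> Pole (\<not> s) \<in> S" if "m dvd 2 * (d - 2 * a s)" for s d
  proof (rule step)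
    have "m dvd d - 2 * a s" using that by (simp only: dvd_double)
    then show "{pt i x, A s d, Pole (\<not> s)} \<in> T"
      using apex[of s d] unfolding partner_or_pole by simp
  qed (use A_ne in auto)
  have centre: "A s 0 \<in> S \<longleftrightarrow> Pole s \<in> S" for s
  proof (rule step)
    have "tri s i x (x - c s i) = {pt i x, A s 0, Pole s}" by (auto simp: tri_def opp_def A_def)
    then show "{pt i x, A s 0, Pole s} \<in> T" using tri_in_T by metis
  qed (use A_ne in auto)
  obtain j G G' where j: "0 \<le> j" "j \<le> 2 * q" and unit: "m dvd G * G' - 1"
    and aT: "m dvd 4 * a True + 2 * j * G" and aF: "m dvd 4 * a False + (2 * j + 1) * G"
    unfolding a_def by (rule layer_parameters[of i]) auto
  have cancel: "m dvd k" if "m dvd k * G" for k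
  proof -
    have "m dvd (k * G) * G' - k * (G * G' - 1)" by (rule dvd_diff[OF dvd_mult2[OF that] dvd_mult[OF unit]])
    also have "(k * G) * G' - k * (G * G' - 1) = k" by (simp add: algebra_simps)
    finally show ?thesis .
  qed
  define M where "M k \<longleftrightarrow> pt i (x + (k - j) * G) \<in> S" for k
  define U where "U s k \<longleftrightarrow> A s ((k - j) * G) \<in> S" for s k
  have mr: "m = 2 * (2 * q) + 1" by (simp add: m_def)
  have M_U: "M k = U s k" if "\<not> m dvd k - j" for k s
    unfolding M_def U_def using that cancel by (intro mid) blast
  have UU: "U True (- k) = U True k" for k
  proof -
    have "4 * a True - (k - j) * G - (- k - j) * G = 4 * a True + 2 * j * G" by (simp add: algebra_simps)
    then have "A True (4 * a True - (k - j) * G) = A True ((- k - j) * G)"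
      using aT by (intro A_cong) (simp only:)
    then show ?thesis unfolding U_def using reflect[of True "(k - j) * G"] by simp
  qed
  have DD: "U False (- 1 - k) = U False k" for k
  proof -
    have "4 * a False - (k - j) * G - (- 1 - k - j) * G = 4 * a False + (2 * j + 1) * G"
      by (simp add: algebra_simps)
    then have "A False (4 * a False - (k - j) * G) = A False ((- 1 - k - j) * G)"
      using aF by (intro A_cong) (simp only:)
    then show ?thesis unfolding U_def using reflect[of False "(k - j) * G"] by simp
  qed
  have "2 * ((0 - j) * G - 2 * a True) = - (4 * a True + 2 * j * G)" by (simp add: algebra_simps)
  then have "m dvd 2 * ((0 - j) * G - 2 * a True)" using aT by (simp only: dvd_minus_iff)
  then have U0: "U True 0 = (Pole False \<in> S)" unfolding U_def using fixed[of _ True] by simp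
  have "2 * ((2 * q - j) * G - 2 * a False) = m * G - (4 * a False + (2 * j + 1) * G)"
    by (simp add: m_def algebra_simps)
  then have "m dvd 2 * ((2 * q - j) * G - 2 * a False)" using dvd_diff[OF dvd_triv_left aF] by (simp only:)
  then have Dr: "U False (2 * q) = (Pole True \<in> S)" unfolding U_def using fixed[of _ False] by simp
  have Uj: "U True j = (Pole True \<in> S)" and Dj: "U False j = (Pole False \<in> S)"
    using centre by (simp_all add: U_def)
  have walk: "(Pole True \<in> S) = (Pole False \<in> S)"
    by (rule dihedral_walk(1)[of m "2 * q" j M "U True" "U False"])
      (rule mr j M_U UU DD U0 Dr Uj Dj | assumption)+
  have walk_all: "U True k = (Pole True \<in> S) \<and> U False k = (Pole True \<in> S) \<and> (k \<noteq> j \<longrightarrow> M k = (Pole True \<in> S))"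
    if "- (2 * q) \<le> k" "k \<le> 2 * q" for k
    by (rule dihedral_walk(2)[of m "2 * q" j M "U True" "U False" "Pole False \<in> S"])
      (rule mr j M_U UU DD U0 Dr Uj Dj that | assumption)+
  have cover: "\<exists>k. - (2 * q) \<le> k \<and> k \<le> 2 * q \<and> m dvd d - (k - j) * G" for d
  proof -
    \<comment> \<open>The index \<open>d * G' + j\<close>, reduced modulo \<open>m\<close> to the range from \<open>- 2 q\<close> to \<open>2 q\<close>.\<close>
    define e where "e = d * G' + j + 2 * q"
    define t where "t = e div m"
    have k: "e mod m = d * G' + j + 2 * q - m * t"
      by (simp add: t_def minus_mult_div_eq_mod flip: e_def)
    have "0 \<le> e mod m" "e mod m < m" using m_pos by simp_all
    then have "- (2 * q) \<le> e mod m - 2 * q" "e mod m - 2 * q \<le> 2 * q" by (simp_all add: m_def)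
    moreover have "d - (e mod m - 2 * q - j) * G = m * (t * G) - d * (G * G' - 1)"
      unfolding k by (simp add: algebra_simps)
    then have "m dvd d - (e mod m - 2 * q - j) * G"
      using dvd_diff[OF dvd_triv_left dvd_mult[OF unit]] by (simp only:)
    ultimately show ?thesis by blast
  qed
  have all: "u \<in> S \<longleftrightarrow> Pole True \<in> S" if u: "u \<in> nbrs T (pt i x)" for u
  proof -
    have "u \<in> V" "u \<noteq> pt i x" using u by (auto simp: nbrs_pt)
    from \<open>u \<in> V\<close> show ?thesis
    proof (cases rule: V_cases)
      case (1 s)
      then show ?thesis using walk by (cases s) auto
    next
      case (2 l y)
      show ?thesis
      proof (cases rule: layer_cases[of l i])
        case 1
        obtain k where k: "- (2 * q) \<le> k" "k \<le> 2 * q" "m dvd (y - x) - (k - j) * G"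
          using cover by blast
        then have u_eq: "u = pt i (x + (k - j) * G)" using 1 2 by (simp add: pt_eq_iff algebra_simps)
        then have "k \<noteq> j" using \<open>u \<noteq> pt i x\<close> by auto
        then show ?thesis using walk_all[OF k(1,2)] u_eq by (simp add: M_def)
      next
        case (2 s)
        obtain k where k: "- (2 * q) \<le> k" "k \<le> 2 * q" "m dvd 2 * (y - x + c s i) - (k - j) * G"
          using cover by blast
        have "y = x + h * (2 * (y - x + c s i)) - c s i + m * - (y - x + c s i)"
          using two_h by (simp add: m_def h_def algebra_simps)
        then have "u = A s (2 * (y - x + c s i))"
          unfolding A_def \<open>u = pt l y\<close> 2 by (rule pt_eqI)
        then have "u = A s ((k - j) * G)" using A_cong[OF k(3)] by simp
        then show ?thesis using walk_all[OF k(1,2)] by (cases s) (auto simp: U_def)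
      qed
    qed
  qed
  then show ?thesis using S by blast
qed

text \<open>The link of a pole runs around the layers; one turn is a translation by \<open>1\<close> or \<open>- 1\<close>, which reaches
every point.\<close>

lemma link_connected_Pole:
  assumes S: "S \<subseteq> nbrs T (Pole s)" "S \<noteq> {}"
    and closed: "\<And>u. u \<in> S \<Longrightarrow> link_nbrs T (Pole s) u \<subseteq> S"
  shows "S = nbrs T (Pole s)"
proof -
  have step: "pt i x \<in> S \<longleftrightarrow> pt (nx s i) (x - c s i) \<in> S" for i x
  proof -
    have "{Pole s, pt i x, pt (nx s i) (x - c s i)} = tri s i x (x - c s i)"
      "{Pole s, pt (nx s i) (x - c s i), pt i x} = tri s i x (x - c s i)"
      by (auto simp: tri_def opp_def)
    then have "pt (nx s i) (x - c s i) \<in> link_nbrs T (Pole s) (pt i x)"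
      "pt i x \<in> link_nbrs T (Pole s) (pt (nx s i) (x - c s i))"
      using tri_in_T by (auto simp: link_nbrs_def pt_eq_iff)
    then show ?thesis using closed by blast
  qed
  have succ: "pt i (x + 1) \<in> S \<longleftrightarrow> pt i x \<in> S" for i x
  proof -
    have three: "nx s (nx s (nx s i)) = i" by (cases s; cases i; simp)
    have round: "pt i y \<in> S \<longleftrightarrow> pt i (y - c s i - c s (nx s i) - c s (nx s (nx s i))) \<in> S" for y
      using step[of i y] step[of "nx s i" "y - c s i"] step[of "nx s (nx s i)" "y - c s i - c s (nx s i)"]
      by (simp add: three)
    show ?thesis
    proof (cases s)
      case True
      then have "c s i + c s (nx s i) + c s (nx s (nx s i)) = 1"
        by (cases i) (simp_all add: shift.simps)
      then have loop: "x + 1 - c s i - c s (nx s i) - c s (nx s (nx s i)) = x" by linarith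
      show ?thesis using round[of "x + 1"] unfolding loop .
    next
      case False
      then have "c s i + c s (nx s i) + c s (nx s (nx s i)) = - 1"
        by (cases i) (simp_all add: shift.simps)
      then have loop: "x - c s i - c s (nx s i) - c s (nx s (nx s i)) = x + 1" by linarith
      show ?thesis using round[of x] unfolding loop by (rule sym)
    qed
  qed
  have zero: "pt i x \<in> S \<longleftrightarrow> pt i 0 \<in> S" for i x
  proof (induction x rule: int_induct[of _ 0])
    case (step1 y)
    then show ?case using succ by simp
  next
    case (step2 y)
    then show ?case using succ[of i "y - 1"] by simp
  qed simp
  have "pt (nx s i) 0 \<in> S \<longleftrightarrow> pt i 0 \<in> S" for i
    using step[of i 0] zero by metis
  then have layers: "pt L1 0 \<in> S \<longleftrightarrow> pt L0 0 \<in> S" "pt L2 0 \<in> S \<longleftrightarrow> pt L0 0 \<in> S"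
    by (cases s; metis nx.simps)+
  have all: "u \<in> S \<longleftrightarrow> pt L0 0 \<in> S" if "u \<in> nbrs T (Pole s)" for u
  proof -
    have "u \<in> V" "u \<notin> range Pole" using that by (auto simp: nbrs_Pole)
    then obtain i x where "u = pt i x" by (auto simp: V_def)
    then show ?thesis using zero layers by (cases i) auto
  qed
  then show ?thesis using S by blast
qed

lemma closed_triangulation_V_T: "closed_triangulation V T"
proof
  show "finite V" by (rule finite_card_V)
  show "V \<noteq> {}" using pt_in_V by blast
  show "t \<subseteq> V \<and> card t = 3" if "t \<in> T" for t using T_sub that by blast
  have nbrs_V: "nbrs T v = V - {v} \<or> nbrs T v = V - range Pole" if "v \<in> V" for v
    using that nbrs_pt nbrs_Pole by (metis V_cases)
  have "range Pole = {Pole True, Pole False}" by (auto simp: UNIV_bool)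
  moreover have "range Pole \<subseteq> V" by (auto simp: V_def)
  ultimately have minus_poles: "card (V - range Pole) = card V - 2"
    by (simp add: card_Diff_subset)
  have large: "7 \<le> card V" using finite_card_V(2) q by simp
  show "4 \<le> card (nbrs T v)" if "v \<in> V" for v
    using nbrs_V[OF that]
  proof
    assume "nbrs T v = V - {v}"
    then have "card (nbrs T v) = card V - 1" using card_Diff_singleton[OF that] by metis
    then show ?thesis using large by linarith
  next
    assume "nbrs T v = V - range Pole"
    then show ?thesis using minus_poles large by simp
  qed
  show "S = nbrs T v" if "v \<in> V" "S \<subseteq> nbrs T v" "S \<noteq> {}" "\<And>u. u \<in> S \<Longrightarrow> link_nbrs T v u \<subseteq> S" for v S
    using that(1)
  proof (cases rule: V_cases)
    case (1 s)
    then show ?thesis using that link_connected_Pole by blast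
  next
    case (2 i x)
    then show ?thesis using that link_connected_pt by blast
  qed
  show "card (link_nbrs T v u) = 2" if "v \<in> V" "u \<in> nbrs T v" for v u
  proof -
    from \<open>u \<in> nbrs T v\<close> obtain t where t: "t \<in> T" "{u, v} \<subseteq> t" "u \<noteq> v"
      by (auto simp: nbrs_def)
    have "{u, v} \<noteq> {Pole True, Pole False}"
      using no_triangle_at_both_poles[OF t(1)] t(2) by metis
    moreover have "u \<in> V" using T_sub[OF t(1)] t(2) by blast
    ultimately show ?thesis using link_card that(1) t(3) by blast
  qed
  show "S = V" if S: "S \<subseteq> V" "S \<noteq> {}" "\<And>u. u \<in> S \<Longrightarrow> nbrs T u \<subseteq> S" for S
  proof -
    have pt: "S = V" if "pt i x \<in> S" for i x
      using S(3)[OF that] that S(1) by (auto simp: nbrs_pt)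
    obtain u where u: "u \<in> S" using S(2) by blast
    then have "u \<in> V" using S(1) by blast
    then show ?thesis
    proof (cases rule: V_cases)
      case (1 s)
      have "pt L0 0 \<in> nbrs T (Pole s)" using pt_in_V by (auto simp: nbrs_Pole)
      then show ?thesis using S(3)[OF u] 1 pt by blast
    next
      case (2 i x)
      then show ?thesis using pt u by blast
    qed
  qed
qed

end

theorem proposition1p2:
  shows "infinite {\<epsilon> :: nat. \<epsilon> \<ge> 1 \<and>
    (\<exists>X :: (real^5) topology. surface X \<and> has_euler_genus X (int \<epsilon>) \<and>
      (\<exists>(V :: nat set) E. simple_graph V E \<and>
        (\<exists>p \<gamma>. graph_embedding X V E p \<gamma> \<and>
          (\<exists>F \<in> faces X V E p \<gamma>. p ` V \<subseteq> X frontier_of F)) \<and>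
        \<not> contains_complete V E (heawood \<epsilon> - 2) \<and>
        \<not> list_colorable (heawood \<epsilon> - 3) V E))}"
    (is "infinite ?Good")
proof -
  define genus :: "nat \<Rightarrow> nat" where "genus k = 24 * (k + 1)\<^sup>2 + 6 * (k + 1)" for k
  have "genus k \<in> ?Good" for k
  proof -
    interpret layered_triangulation "int (k + 1)" by unfold_locales simp
    define n where "n = 12 * k + 17"
    have card: "card V = n" using finite_card_V(2) by (simp add: n_def nat_add_distrib algebra_simps)
    have euler: "6 * genus k + 2 = (n - 3) * (n - 4)"
      by (simp add: n_def genus_def power2_eq_square algebra_simps)
    have "6 \<le> n" by (simp add: n_def)
    show ?thesis
    proof (intro CollectI conjI)
      show "1 \<le> genus k" by (simp add: genus_def)
    qed (rule near_complete_triangulation_example[OF closed_triangulation_V_T Pole_in_V[of True]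
          Pole_in_V[of False] _ no_triangle_at_both_poles edge_in_triangle card \<open>6 \<le> n\<close> euler];
        (assumption | simp))
  qed
  then have "range genus \<subseteq> ?Good" by blast
  moreover have "strict_mono genus"
    by (rule strict_monoI_Suc) (simp add: genus_def power2_eq_square)
  then have "infinite (range genus)"
    using range_inj_infinite strict_mono_imp_inj_on by blast
  ultimately show ?thesis using infinite_super by blast
qed

end
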